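(* Let $q$ be a positive integer, let $\mathscr{B}\colon X\to^? q$ be a Borel CSP on a standard Borel space $X$, and let $s\in\mathbb{N}$. Suppose that $\mathrm{si}(G_{\mathscr{B}})\leq s<\infty$. If \[ \mathsf{p}(\mathscr{B})\,(\mathsf{d}(\mathscr{B})+1)^{s+1}\,\leq\, e^{-s-1}, \] then $\mathscr{B}$ has a Borel solution $f\colon X\to q$.
   Context: $\mathbb{N}=\{0,1,2,\dots\}$, and $q\in\mathbb{N}$ is identified with $\{0,\dots,q-1\}$. CSPs. Let $X$ be a set and $q$ a positive integer. An $(X,q)$-constraint with domain a finite set $D\subseteq X$ is a set $B\subseteq q^D$ of functions $D\to q$; write $\mathrm{dom}(B)=D$. A function $f\colon X\to q$ violates $B$ if $f|_{\mathrm{dom}(B)}\in B$, and satisfies $B$ otherwise. A constraint satisfaction problem (CSP) $\mathscr{B}\colon X\to^? q$ is a set of $(X,q)$-constraints; a solution to it is a function $f\colon X\to q$ satisfying every $B\in\mathscr{B}$. Put $\mathbb{P}[B]=|B|/q^{|\mathrm{dom}(B)|}$, $\mathsf{p}(\mathscr{B})=\sup_{B\in\mathscr{B}}\mathbb{P}[B]$, and $\mathsf{d}(\mathscr{B})=\sup_{B\in\mathscr{B}}|\{B'\in\mathscr{B}: B'\neq B,\ \mathrm{dom}(B')\cap\mathrm{dom}(B)\neq\varnothing\}|$. Inequalities involving $\mathsf{d}(\mathscr{B})$ are understood to include $\mathsf{d}(\mathscr{B})<\infty$. $G_{\mathscr{B}}$ is the graph with vertex set $X$ in which distinct $x,y$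 are adjacent iff some $B\in\mathscr{B}$ has $x,y\in\mathrm{dom}(B)$. Borel CSPs. For a standard Borel space $X$, the set $[X]^k$ of $k$-element subsets carries the quotient standard Borel structure from the $k$-tuples of distinct points, and the set $[X]^{<\infty}=\bigsqcup_k[X]^k$ of finite subsets carries the disjoint union structure. The set of finite partial functions $X\rightharpoonup q$ (identified with their graphs) is a Borel subset of $[X\times q]^{<\infty}$. The set $\mathrm{Const}(X,q)$ of all $(X,q)$-constraints, viewed as finite sets of finite partial functions $X\rightharpoonup q$ with a common domain, is a Borel subset of the space of finite subsets of that space, hence is standard Borel. A CSP $\mathscr{B}\colon X\to^? q$ is Borel if it is a Borel subset of $\mathrm{Const}(X,q)$. (If $\mathscr{B}$ is Borel and $\mathsf{d}(\mathscr{B})<\infty$, then $G_{\mathscr{B}}$ is a locally finite Borel graph, i.e. its adjacency relation is Borel in $X^2$.) Separation index. A graph is component-finite if all its connected components are finite. For a Borel graph $G$, $\mathrm{si}(G)$ is the smallest $s\in\mathbb{N}$ for which there is a partition $V(G)=U_0\sqcup\dots\sqcup U_s$ into $s+1$ Borel sets such that every induced subgraph $G[U_i]$ is component-finite ($\infty$ if no such $s$ exists). *)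

theory Defs
  imports "HOL-Analysis.Analysis"
begin

section \<open>Standard Borel spaces and spaces of finite subsets\<close>

text \<open>
  Measurable spaces are represented, as usual, by the type \<open>'a measure\<close>; only \<^const>\<open>space\<close> and
  \<^const>\<open>sets\<close> matter, and the members of \<^const>\<open>sets\<close> are the Borel sets.
\<close>

definition standard_borel :: "'a measure \<Rightarrow> bool" where
  "standard_borel M \<longleftrightarrow>
     (\<exists>T. completely_metrizable_space T \<and> separable_space T \<and> topspace T = space M \<and>
          sets M = sigma_sets (space M) {U. openin T U})"

text \<open>The \<open>k\<close>-tuples of distinct points of \<open>M\<close>, indexed by \<open>{..<k}\<close>.\<close>

definition distinct_tuples :: "'a measure \<Rightarrow> nat \<Rightarrow> (nat \<Rightarrow> 'a) measure" where
  "distinct_tuples M k = restrict_space (PiM {..<k} (\<lambda>_. M)) {x. inj_on x {..<k}}"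

text \<open>
  The finite subsets of \<open>M\<close>, with the disjoint union over \<open>k\<close> of the quotient structures under the
  maps \<open>x \<mapsto> {x\<^sub>0, \<dots>, x\<^bsub>k-1\<^esub>}\<close> from the distinct \<open>k\<close>-tuples onto the \<open>k\<close>-element subsets: a set of
  finite sets is Borel iff all its preimages under these maps are.
\<close>

definition finite_subsets :: "'a measure \<Rightarrow> 'a set measure" where
  "finite_subsets M = sigma (Fpow (space M))
     {A. A \<subseteq> Fpow (space M) \<and>
         (\<forall>k. {x \<in> space (distinct_tuples M k). x ` {..<k} \<in> A} \<in> sets (distinct_tuples M k))}"

lemma space_finite_subsets: "space (finite_subsets M) = Fpow (space M)"
  unfolding finite_subsets_def by (rule space_measure_of) auto

text \<open>The generating family is already a sigma-algebra.\<close>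

lemma sets_finite_subsets:
  "sets (finite_subsets M) =
     {A. A \<subseteq> Fpow (space M) \<and>
         (\<forall>k. {x \<in> space (distinct_tuples M k). x ` {..<k} \<in> A} \<in> sets (distinct_tuples M k))}"
  (is "_ = ?S")
proof -
  have image_Fpow: "x ` {..<k} \<in> Fpow (space M)" if "x \<in> space (distinct_tuples M k)" for x k
    using that by (auto simp: distinct_tuples_def space_restrict_space space_PiM Fpow_def)
  have "sigma_algebra (Fpow (space M)) ?S"
    unfolding sigma_algebra_iff2
  proof (intro conjI ballI allI impI)
    show "?S \<subseteq> Pow (Fpow (space M))" by auto
    show "{} \<in> ?S" by auto
  next
    fix A assume A: "A \<in> ?S"
    have "{x \<in> space (distinct_tuples M k). x ` {..<k} \<in> Fpow (space M) - A} =
      space (distinct_tuples M k) - {x \<in> space (distinct_tuples M k). x ` {..<k} \<in> A}" for k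
      using image_Fpow by auto
    moreover have "{x \<in> space (distinct_tuples M k). x ` {..<k} \<in> A} \<in> sets (distinct_tuples M k)" for k
      using A by blast
    ultimately have "{x \<in> space (distinct_tuples M k). x ` {..<k} \<in> Fpow (space M) - A}
      \<in> sets (distinct_tuples M k)" for k
      by (simp only: sets.compl_sets)
    then show "Fpow (space M) - A \<in> ?S" by blast
  next
    fix A :: "nat \<Rightarrow> _" assume A: "range A \<subseteq> ?S"
    have "{x \<in> space (distinct_tuples M k). x ` {..<k} \<in> (\<Union>i. A i)} =
      (\<Union>i. {x \<in> space (distinct_tuples M k). x ` {..<k} \<in> A i})" for k
      by auto
    moreover have "(\<Union>i. {x \<in> space (distinct_tuples M k). x ` {..<k} \<in> A i})
      \<in> sets (distinct_tuples M k)" for k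
      using A by (intro sets.countable_UN image_subsetI) blast
    ultimately have "{x \<in> space (distinct_tuples M k). x ` {..<k} \<in> (\<Union>i. A i)}
      \<in> sets (distinct_tuples M k)" for k
      by (simp only:)
    then show "(\<Union>i. A i) \<in> ?S" using A by blast
  qed
  then show ?thesis
    unfolding finite_subsets_def by (rule sigma_algebra.sets_measure_of_eq)
qed


section \<open>Constraint satisfaction problems\<close>

text \<open>The finite partial functions from \<open>X\<close> to \<open>q = {0, \<dots>, q - 1}\<close>.\<close>

definition finite_partial_functions :: "'a set \<Rightarrow> nat \<Rightarrow> ('a \<rightharpoonup> nat) set" where
  "finite_partial_functions X q = {g. finite (dom g) \<and> dom g \<subseteq> X \<and> ran g \<subseteq> {..<q}}"

definition is_constraint :: "'a set \<Rightarrow> nat \<Rightarrow> ('a \<rightharpoonup> nat) set \<Rightarrow> bool" where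
  "is_constraint X q B \<longleftrightarrow>
     (\<exists>D. finite D \<and> D \<subseteq> X \<and> B \<subseteq> {g. dom g = D \<and> ran g \<subseteq> {..<q}})"

text \<open>
  The common domain of the members of a constraint. A set of partial functions determines it unless
  it is empty; the empty constraint, which is never violated, is given the domain \<open>{}\<close>.
\<close>

definition constraint_dom :: "('a \<rightharpoonup> nat) set \<Rightarrow> 'a set" where
  "constraint_dom B = (\<Union>g\<in>B. dom g)"

lemma constraint_dom_eq:
  assumes "B \<subseteq> {g. dom g = D \<and> ran g \<subseteq> {..<q}}" "B \<noteq> {}"
  shows "constraint_dom B = D"
proof -
  have "dom g = D" if "g \<in> B" for g
    using assms(1) that by blast
  then have "constraint_dom B = (\<Union>g\<in>B. D)"
    unfolding constraint_dom_def by (rule SUP_cong[OF refl])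
  with assms(2) show ?thesis by simp
qed

definition violates :: "('a \<Rightarrow> nat) \<Rightarrow> ('a \<rightharpoonup> nat) set \<Rightarrow> bool" where
  "violates f B \<longleftrightarrow> (Some \<circ> f) |` constraint_dom B \<in> B"

definition is_csp :: "'a set \<Rightarrow> nat \<Rightarrow> ('a \<rightharpoonup> nat) set set \<Rightarrow> bool" where
  "is_csp X q \<B> \<longleftrightarrow> (\<forall>B\<in>\<B>. is_constraint X q B)"

definition is_solution :: "'a set \<Rightarrow> nat \<Rightarrow> ('a \<rightharpoonup> nat) set set \<Rightarrow> ('a \<Rightarrow> nat) \<Rightarrow> bool" where
  "is_solution X q \<B> f \<longleftrightarrow> f \<in> X \<rightarrow> {..<q} \<and> (\<forall>B\<in>\<B>. \<not> violates f B)"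

definition constraint_prob :: "nat \<Rightarrow> ('a \<rightharpoonup> nat) set \<Rightarrow> real" where
  "constraint_prob q B = real (card B) / real q ^ card (constraint_dom B)"

text \<open>
  The suprema are taken in \<^typ>\<open>ennreal\<close> and \<^typ>\<open>enat\<close>, so that they always exist and are \<open>0\<close> for
  the empty CSP.
\<close>

definition csp_p :: "nat \<Rightarrow> ('a \<rightharpoonup> nat) set set \<Rightarrow> ennreal" where
  "csp_p q \<B> = (SUP B\<in>\<B>. ennreal (constraint_prob q B))"

definition csp_neighbours :: "('a \<rightharpoonup> nat) set set \<Rightarrow> ('a \<rightharpoonup> nat) set \<Rightarrow> ('a \<rightharpoonup> nat) set set" where
  "csp_neighbours \<B> B = {B'\<in>\<B>. B' \<noteq> B \<and> constraint_dom B' \<inter> constraint_dom B \<noteq> {}}"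

definition csp_d :: "('a \<rightharpoonup> nat) set set \<Rightarrow> enat" where
  "csp_d \<B> = (SUP B\<in>\<B>.
     if finite (csp_neighbours \<B> B) then enat (card (csp_neighbours \<B> B)) else \<infinity>)"

text \<open>The adjacency relation of \<open>G\<^sub>\<B>\<close>, a graph with vertex set \<open>X\<close>.\<close>

definition csp_graph :: "'a set \<Rightarrow> ('a \<rightharpoonup> nat) set set \<Rightarrow> ('a \<times> 'a) set" where
  "csp_graph X \<B> = {(x, y) \<in> X \<times> X. x \<noteq> y \<and>
     (\<exists>B\<in>\<B>. x \<in> constraint_dom B \<and> y \<in> constraint_dom B)}"


section \<open>Borel CSPs\<close>

text \<open>Partial functions carry the Borel structure of their graphs.\<close>

definition partial_function_space :: "'a measure \<Rightarrow> nat \<Rightarrow> ('a \<rightharpoonup> nat) measure" where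
  "partial_function_space M q =
     vimage_algebra (finite_partial_functions (space M) q) Map.graph
       (finite_subsets (M \<Otimes>\<^sub>M count_space {..<q}))"

definition constraint_space :: "'a measure \<Rightarrow> nat \<Rightarrow> ('a \<rightharpoonup> nat) set measure" where
  "constraint_space M q =
     restrict_space (finite_subsets (partial_function_space M q)) {B. is_constraint (space M) q B}"

definition borel_csp :: "'a measure \<Rightarrow> nat \<Rightarrow> ('a \<rightharpoonup> nat) set set \<Rightarrow> bool" where
  "borel_csp M q \<B> \<longleftrightarrow> is_csp (space M) q \<B> \<and> \<B> \<in> sets (constraint_space M q)"

text \<open>Every constraint is a point of the constraint space.\<close>

lemma space_constraint_space:
  "space (constraint_space M q) = {B. is_constraint (space M) q B}"
proof -
  have "B \<in> Fpow (finite_partial_functions (space M) q)" if "is_constraint (space M) q B" for B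
  proof -
    obtain D where D: "finite D" "D \<subseteq> space M" "B \<subseteq> {g. dom g = D \<and> ran g \<subseteq> {..<q}}"
      using \<open>is_constraint (space M) q B\<close> unfolding is_constraint_def by blast
    have "finite {g :: 'a \<rightharpoonup> nat. dom g = D \<and> ran g \<subseteq> {..<q}}"
      using D(1) by (intro finite_set_of_finite_maps) auto
    then have "finite B" using D(3) by (rule finite_subset[rotated])
    moreover have "g \<in> finite_partial_functions (space M) q" if "g \<in> B" for g
    proof -
      have "dom g = D" "ran g \<subseteq> {..<q}" using D(3) that by blast+
      with D(1,2) show ?thesis by (simp add: finite_partial_functions_def)
    qed
    ultimately show ?thesis unfolding Fpow_def by blast
  qed
  then show ?thesis
    unfolding constraint_space_def space_restrict_space space_finite_subsets
      partial_function_space_def space_vimage_algebra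
    by blast
qed


section \<open>Separation index\<close>

text \<open>
  A graph is given by a vertex set and a symmetric adjacency relation \<open>E\<close>; the subgraph induced by
  \<open>U\<close> then has adjacency relation \<open>E \<inter> U \<times> U\<close>.
\<close>

definition component_finite :: "'a set \<Rightarrow> ('a \<times> 'a) set \<Rightarrow> bool" where
  "component_finite V E \<longleftrightarrow> (\<forall>x\<in>V. finite (E\<^sup>* `` {x}))"

text \<open>The parts of the partition are allowed to be empty, and \<open>Inf {} = \<infinity>\<close> in \<^typ>\<open>enat\<close>.\<close>

definition separation_index :: "'a measure \<Rightarrow> ('a \<times> 'a) set \<Rightarrow> enat" where
  "separation_index M E = Inf (enat ` {s.
     \<exists>U. (\<forall>i\<le>s. U i \<in> sets M) \<and> disjoint_family_on U {..s} \<and> (\<Union>i\<le>s. U i) = space M \<and>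
         (\<forall>i\<le>s. component_finite (U i) (E \<inter> U i \<times> U i))})"

end

theory Submission
  imports Defs
begin

text \<open>
  The sets \<open>U\<^sub>0, \<dots>, U\<^sub>s\<close> that witness the separation index are coloured one after the other. What is
  tracked is, for each constraint, the conditional probability that it will be violated given the
  colours fixed so far, the remaining points being coloured uniformly at random (\<open>cond_prob\<close>). Put
  \<open>\<theta> = e (d + 1)\<close>. When the points of \<open>U\<^sub>i\<close> are coloured, call it a bad event for a constraint that its
  conditional probability grows by a factor of at least \<open>\<theta>\<close>. The conditional probability is a
  martingale, so by Markov's inequality a bad event has probability at most \<open>1 / \<theta>\<close>, which is exactly
  what the symmetric local lemma tolerates for \<open>d\<close> dependencies. All bad events can therefore be
  avoided, and after the last stage every conditional probability is \<open>0\<close> or less than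
  \<open>\<theta> ^ (s + 1) * p \<le> 1\<close>. But then everything is revealed and a violated constraint has conditional probability
  \<open>1\<close>.

  Because the components of the graph on \<open>U\<^sub>i\<close> are finite, the local lemma is needed only for finitely
  many events over a finite set of points (\<open>finite_local_lemma\<close>, proved by counting), separately for
  each component (\<open>component_colouring\<close>). The remaining question is how to choose the solutions on all
  components simultaneously in a Borel way (\<open>borel_stage\<close>). There is a countable family of Borel
  colourings \<open>\<phi>\<^sub>k\<close> which realizes every colouring of every finite set (\<open>borel_extension_family\<close>). On
  each component use \<open>\<phi>\<^sub>k\<close> with the least \<open>k\<close> for which it avoids the bad events there. The set of
  points whose component meets a bad event under \<open>\<phi>\<^sub>k\<close> is obtained from the points of violated
  constraints by countably many steps to adjacent points, so what has to be shown is that the points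
  of those constraints that have a given Borel property form a Borel set
  (\<open>sets_points_of_constraints\<close>).

  That is a projection of a Borel set of tuples, and projections of Borel sets are not Borel in
  general. It is here that finiteness of \<open>d\<close> enters a second time: a point lies in at most \<open>d + 1\<close>
  constraints, so the projection is bounded-to-one, and bounded-to-one Borel images of Borel sets are
  Borel (\<open>borel_image_bounded_to_one\<close>). This is proved in the Baire space from Lusin's separation
  theorem for analytic sets (\<open>analytic_separation\<close>), and carried over to standard Borel
  spaces by realizing the nonempty ones as Borel retracts of the Baire space (\<open>baire_retraction\<close>).
\<close>

section \<open>Analytic subsets of the Baire space\<close>

type_synonym baire = "nat \<Rightarrow> nat"

definition analytic :: "baire set \<Rightarrow> bool" where
  "analytic A \<longleftrightarrow> (\<exists>C :: (baire \<times> baire) set. closed C \<and> A = fst ` C)"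

lemma tendsto_baire:
  fixes x :: "nat \<Rightarrow> baire"
  assumes "\<And>n i. i < n \<Longrightarrow> x n i = l i"
  shows "x \<longlonglongrightarrow> l"
proof -
  have "limitin (product_topology (\<lambda>_. euclidean) UNIV) x l sequentially"
    unfolding limitin_componentwise
  proof (intro conjI ballI)
    fix i :: nat
    have "eventually (\<lambda>n. x n i = l i) sequentially"
      using eventually_gt_at_top[of i] by eventually_elim (rule assms)
    then show "limitin euclidean (\<lambda>n. x n i) (l i) sequentially"
      by (simp add: tendsto_eventually)
  qed (auto simp: extensional_def)
  then show ?thesis
    by (simp add: euclidean_product_topology)
qed

lemma closed_limit_of_approximations:
  fixes C :: "(baire \<times> baire) set"
  assumes "closed C"
    and "\<And>n. \<exists>x' z'. (x', z') \<in> C \<and> (\<forall>i<n. x' i = x i \<and> z' i = z i)"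
  shows "(x, z) \<in> C"
proof -
  obtain x' z' where *: "\<And>n. (x' n, z' n) \<in> C" "\<And>n i. i < n \<Longrightarrow> x' n i = x i"
    "\<And>n i. i < n \<Longrightarrow> z' n i = z i"
    using assms(2) by metis
  have "(\<lambda>n. (x' n, z' n)) \<longlonglongrightarrow> (x, z)"
    using * by (intro tendsto_Pair tendsto_baire) auto
  then show ?thesis
    by (rule closed_sequentially[OF assms(1) *(1)])
qed

lemma continuous_fst_coordinate: "continuous_on UNIV (\<lambda>p :: baire \<times> baire. fst p i)"
  and continuous_snd_coordinate: "continuous_on UNIV (\<lambda>p :: baire \<times> baire. snd p i)"
  using continuous_on_compose2[OF continuous_on_product_coordinates, of UNIV fst i]
    continuous_on_compose2[OF continuous_on_product_coordinates, of UNIV snd i]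
  by (simp_all add: continuous_on_fst continuous_on_snd)

lemma continuous_reindex:
  "continuous_on UNIV (\<lambda>p :: baire \<times> baire. (\<lambda>i. fst p (a i), \<lambda>i. snd p (b i)))"
  by (intro continuous_on_Pair continuous_on_coordinatewise_then_product
      continuous_fst_coordinate continuous_snd_coordinate)

lemma closed_reindex:
  "closed C \<Longrightarrow> closed {(x :: baire, z :: baire). (\<lambda>i. x (a i), \<lambda>i. z (b i)) \<in> C}"
  using closed_vimage[OF _ continuous_reindex[of a b]]
  by (simp add: vimage_def case_prod_unfold)

lemma closed_coordinate: "closed {x :: baire. P (x i)}" 
proof -
  have "closed ((\<lambda>x :: baire. x i) -` Collect P)"
    by (intro closed_vimage continuous_on_product_coordinates) 
      (simp add: closed_def open_discrete)
  then show ?thesis by (simp add: vimage_def)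
qed

lemma closed_snd_coordinate: "closed {(x :: baire, z :: baire). P (z i)}"
proof -
  have "closed (snd -` {z :: baire. P (z i)} :: (baire \<times> baire) set)"
    by (intro closed_vimage closed_coordinate continuous_intros)
  then show ?thesis by (simp add: vimage_def case_prod_unfold)
qed

text \<open>
  A witness for \<open>x \<in> \<Union>n. A n\<close> is an index \<open>n\<close> followed by a witness for \<open>x \<in> A n\<close>; a witness for
  \<open>x \<in> \<Inter>n. A n\<close> is a sequence of witnesses, interleaved by the pairing function.
\<close>

lemma analytic_UN:
  fixes A :: "nat \<Rightarrow> baire set"
  assumes "\<And>n. analytic (A n)"
  shows "analytic (\<Union>n. A n)"
proof -
  obtain C :: "nat \<Rightarrow> (baire \<times> baire) set"
    where C: "\<And>n. closed (C n)" "\<And>n. A n = fst ` C n"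
    using assms unfolding analytic_def by metis
  define D where "D = (\<Inter>n. {(x :: baire, z :: baire). z 0 \<noteq> n} \<union>
    {(x, z). (\<lambda>i. x (id i), \<lambda>i. z (Suc i)) \<in> C n})"
  have "closed D"
    unfolding D_def by (intro closed_INT ballI closed_Un closed_snd_coordinate closed_reindex C)
  moreover have "(\<Union>n. A n) = fst ` D"
  proof (intro set_eqI iffI)
    fix x assume "x \<in> (\<Union>n. A n)"
    then obtain n z where "(x, z) \<in> C n" by (auto simp: C(2))
    then have "(x, case_nat n z) \<in> D" by (auto simp: D_def)
    then show "x \<in> fst ` D" by force
  next
    fix x assume "x \<in> fst ` D"
    then obtain z where "(x, z) \<in> D" by auto
    then have "(x, \<lambda>i. z (Suc i)) \<in> C (z 0)" by (auto simp: D_def)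
    then show "x \<in> (\<Union>n. A n)" unfolding C(2) by force
  qed
  ultimately show ?thesis unfolding analytic_def by blast
qed

lemma analytic_INT:
  fixes A :: "nat \<Rightarrow> baire set"
  assumes "\<And>n. analytic (A n)"
  shows "analytic (\<Inter>n. A n)"
proof -
  obtain C :: "nat \<Rightarrow> (baire \<times> baire) set"
    where C: "\<And>n. closed (C n)" "\<And>n. A n = fst ` C n"
    using assms unfolding analytic_def by metis
  define D where "D = (\<Inter>n. {(x :: baire, z :: baire).
      (\<lambda>i. x (id i), \<lambda>i. z (prod_encode (n, i))) \<in> C n})"
  have "closed D"
    unfolding D_def by (intro closed_INT ballI closed_reindex C)
  moreover have "(\<Inter>n. A n) = fst ` D"
  proof (intro set_eqI iffI)
    fix x assume "x \<in> (\<Inter>n. A n)"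
    then have "\<forall>n. \<exists>z. (x, z) \<in> C n" unfolding C(2) by force
    then obtain z where "\<forall>n. (x, z n) \<in> C n" by metis
    then have "(x, \<lambda>k. case_prod z (prod_decode k)) \<in> D" by (auto simp: D_def)
    then show "x \<in> fst ` D" by force
  next
    fix x assume "x \<in> fst ` D"
    then obtain z where "(x, z) \<in> D" by auto
    then have "(x, \<lambda>i. z (prod_encode (n, i))) \<in> C n" for n by (auto simp: D_def)
    then show "x \<in> (\<Inter>n. A n)" unfolding C(2) by force
  qed
  ultimately show ?thesis unfolding analytic_def by blast
qed

lemma analytic_closed:
  assumes "closed A"
  shows "analytic A"
proof -
  have "closed (A \<times> (UNIV :: baire set))" using assms by (intro closed_Times) auto
  moreover have "A = fst ` (A \<times> (UNIV :: baire set))" by auto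
  ultimately show ?thesis unfolding analytic_def by blast
qed

lemma measurable_borel_nat: "measurable M (borel :: nat measure) = measurable M (count_space UNIV)"
  by (rule measurable_cong_sets[OF refl sets_borel_eq_count_space])

lemma measurable_coordinate [measurable]: "(\<lambda>x :: baire. x i) \<in> measurable borel (count_space UNIV)"
  using measurable_product_coordinates[of i, where 'b = nat] by (simp only: measurable_borel_nat)

lemma measurable_baireI:
  fixes f :: "'a \<Rightarrow> baire"
  assumes "\<And>i. (\<lambda>x. f x i) \<in> measurable M (count_space UNIV)"
  shows "f \<in> borel_measurable M"
  using assms by (intro measurable_coordinatewise_then_product) (simp only: measurable_borel_nat)

lemma pred_eq_baire [measurable (raw)]:
  fixes f g :: "'a \<Rightarrow> baire"
  assumes [measurable]: "f \<in> borel_measurable M" "g \<in> borel_measurable M"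
  shows "Measurable.pred M (\<lambda>x. f x = g x)"
proof -
  have [measurable]: "(\<lambda>x. f x i) \<in> measurable M (count_space UNIV)"
    "(\<lambda>x. g x i) \<in> measurable M (count_space UNIV)" for i
    using measurable_compose[OF assms(1) measurable_coordinate]
      measurable_compose[OF assms(2) measurable_coordinate] by blast+
  have "(\<lambda>x. f x = g x) = (\<lambda>x. \<forall>i. \<exists>n. f x i = n \<and> g x i = n)"
    by (auto simp: fun_eq_iff)
  then show ?thesis by (simp only:) measurable
qed

text \<open>
  The sets that are analytic together with their complement form a sigma-algebra. It contains the
  subbasic sets \<open>{x. x i \<in> S}\<close>, because these are clopen.
\<close>

lemma analytic_borel:
  assumes "A \<in> sets (borel :: baire measure)"
  shows "analytic A"
proof -
  let ?G = "{{x :: baire. x i \<in> S} | i S. True}"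
  have "sets (borel :: baire measure) = sets (PiM UNIV (\<lambda>_ :: nat. count_space (UNIV :: nat set)))"
    by (subst sets_PiM_equal_borel[symmetric])
       (intro sets_PiM_cong refl sets_borel_eq_count_space)
  also have "\<dots> = sigma_sets UNIV ?G"
    unfolding sets_PiM_single by simp
  finally have "A \<in> sigma_sets UNIV ?G" using assms by simp
  then have "analytic A \<and> analytic (- A)"
  proof induction
    case (Basic a)
    then obtain i S where a: "a = {x. x i \<in> S}" by blast
    then have "- a = {x. x i \<notin> S}" by auto
    then show ?case using a by (auto intro!: analytic_closed closed_coordinate)
  next
    case Empty
    then show ?case by (auto intro!: analytic_closed)
  next
    case (Compl a)
    then show ?case by (simp only: Compl_eq_Diff_UNIV[symmetric] double_complement simp_thms)
  next
    case (Union a)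
    then show ?case by (metis Compl_UN analytic_INT analytic_UN)
  qed
  then show ?thesis ..
qed

text \<open>
  A homeomorphism of the Baire space with its square, so that pairs of points can be treated as points.
\<close>

definition join :: "baire \<Rightarrow> baire \<Rightarrow> baire" where
  "join x y = (\<lambda>i. if even i then x (i div 2) else y (i div 2))"

definition left :: "baire \<Rightarrow> baire" where "left u = (\<lambda>i. u (2 * i))"
definition right :: "baire \<Rightarrow> baire" where "right u = (\<lambda>i. u (2 * i + 1))"

lemma left_join [simp]: "left (join x y) = x" and right_join [simp]: "right (join x y) = y"
  and join_left_right [simp]: "join (left u) (right u) = u"
  by (auto simp: join_def left_def right_def fun_eq_iff)

lemma measurable_left [measurable]: "left \<in> borel_measurable borel"
  and measurable_right [measurable]: "right \<in> borel_measurable borel"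
  unfolding left_def right_def by (intro measurable_baireI; measurable)+

text \<open>
  The other half of the point, joined with a witness for membership in \<open>A\<close>, is a witness for membership
  in the projection.
\<close>

lemma analytic_left_image:
  assumes "analytic A"
  shows "analytic (left ` A)"
proof -
  obtain C :: "(baire \<times> baire) set" where C: "closed C" "A = fst ` C" using assms unfolding analytic_def by blast
  define g :: "baire \<times> baire \<Rightarrow> baire \<times> baire" where "g = (\<lambda>(x, w). (join x (left w), right w))"
  have "continuous_on UNIV (\<lambda>p :: baire \<times> baire. join (fst p) (left (snd p)) i)" for i
    by (cases "even i")
      (simp_all add: join_def left_def continuous_fst_coordinate continuous_snd_coordinate)
  moreover have "continuous_on UNIV (\<lambda>p :: baire \<times> baire. right (snd p))"
    unfolding right_def
    by (intro continuous_on_coordinatewise_then_product continuous_snd_coordinate)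
  ultimately have "continuous_on UNIV g"
    unfolding g_def case_prod_unfold
    by (intro continuous_on_Pair) (rule continuous_on_coordinatewise_then_product)
  then have "closed (g -` C)" using C(1) by (intro closed_vimage)
  moreover have "left ` A = fst ` (g -` C)"
  proof (intro set_eqI iffI)
    fix x assume "x \<in> left ` A"
    then obtain u z where "(u, z) \<in> C" "x = left u" using C(2) by auto
    then have "(x, join (right u) z) \<in> g -` C" by (simp add: g_def)
    then show "x \<in> fst ` (g -` C)" by force
  next
    fix x assume "x \<in> fst ` (g -` C)"
    then obtain w where "(join x (left w), right w) \<in> C" by (auto simp: g_def)
    then have "join x (left w) \<in> A" using C(2) by force
    then show "x \<in> left ` A" by (metis imageI left_join)
  qed
  ultimately show ?thesis unfolding analytic_def by blast
qed

text \<open>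
  The image is the projection of the graph of \<open>F\<close> over \<open>Q\<close>, and the graph of a Borel function is
  Borel.
\<close>

lemma analytic_image:
  fixes F :: "baire \<Rightarrow> baire"
  assumes [measurable]: "Q \<in> sets borel" "F \<in> borel_measurable borel"
  shows "analytic (F ` Q)"
proof -
  have "{u. right u \<in> Q \<and> left u = F (right u)} \<in> sets borel" by measurable
  then have "analytic (left ` {u. right u \<in> Q \<and> left u = F (right u)})"
    by (intro analytic_left_image analytic_borel)
  moreover have "left ` {u. right u \<in> Q \<and> left u = F (right u)} = F ` Q"
  proof (intro set_eqI iffI)
    fix y assume "y \<in> F ` Q"
    then obtain x where "x \<in> Q" "y = F x" by blast
    then show "y \<in> left ` {u. right u \<in> Q \<and> left u = F (right u)}"
      by (intro image_eqI[of _ _ "join y x"]) auto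
  qed auto
  ultimately show ?thesis by simp
qed


section \<open>Lusin's separation theorem\<close>

definition borel_separated :: "baire set \<Rightarrow> baire set \<Rightarrow> bool" where
  "borel_separated A A' \<longleftrightarrow> (\<exists>D\<in>sets borel. A \<subseteq> D \<and> D \<inter> A' = {})"

text \<open>
  If \<open>D i j\<close> separates \<open>A i\<close> from \<open>A' j\<close>, then \<open>\<Union>i. \<Inter>j. D i j\<close> separates the unions.
\<close>

lemma borel_separated_UN:
  fixes A A' :: "'i :: countable \<Rightarrow> baire set"
  assumes "\<And>i j. borel_separated (A i) (A' j)"
  shows "borel_separated (\<Union>i. A i) (\<Union>j. A' j)"
proof -
  obtain D where D: "\<And>i j. D i j \<in> sets borel" "\<And>i j. A i \<subseteq> D i j" "\<And>i j. D i j \<inter> A' j = {}"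
    using assms unfolding borel_separated_def by metis
  have "(\<Union>i. \<Inter>j. D i j) \<in> sets borel"
    using D(1) by (intro sets.countable_UN' sets.countable_INT') auto
  moreover have "(\<Union>i. A i) \<subseteq> (\<Union>i. \<Inter>j. D i j)" using D(2) by blast
  moreover have "(\<Union>i. \<Inter>j. D i j) \<inter> (\<Union>j. A' j) = {}" using D(3) by blast
  ultimately show ?thesis unfolding borel_separated_def by blast
qed

lemma borel_separated_empty: "borel_separated {} A" "borel_separated A {}"
  unfolding borel_separated_def by (auto intro: bexI[of _ "{}"] bexI[of _ UNIV])

text \<open>
  Lusin's separation theorem. If the two sets could not be separated, then by
  \<open>borel_separated_UN\<close> the same would hold for some pair of pieces with one more digit of the point and
  of the two witnesses prescribed, and the digits of the points in the two pieces agree, since different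
  digits are told apart by a clopen set. In the limit the digits describe a point with a witness for
  each of the two closed sets, that is, a common point of the two analytic sets.
\<close>

theorem analytic_separation:
  assumes "analytic A" "analytic A'" "A \<inter> A' = {}"
  shows "borel_separated A A'"
proof (rule ccontr)
  assume not_sep: "\<not> borel_separated A A'"
  obtain C C' :: "(baire \<times> baire) set" where
    C: "closed C" "A = fst ` C" and C': "closed C'" "A' = fst ` C'"
    using assms(1,2) unfolding analytic_def by metis
  define piece where "piece E n x z = {y. \<exists>w. (y, w) \<in> E \<and> (\<forall>i<n. y i = x i \<and> w i = z i)}"
    for E :: "(baire \<times> baire) set" and n and x z :: baire
  define bad where "bad n t = (case t of (x, z, z') \<Rightarrow>
    \<not> borel_separated (piece C n x z) (piece C' n x z'))" for n t
  have split: "piece E n x z = (\<Union>(a, b). piece E (Suc n) (x(n := a)) (z(n := b)))" for E n x z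
  proof (intro set_eqI iffI)
    fix y assume "y \<in> piece E n x z"
    then obtain w where "(y, w) \<in> E" "\<forall>i<n. y i = x i \<and> w i = z i"
      unfolding piece_def by blast
    then have "y \<in> piece E (Suc n) (x(n := y n)) (z(n := w n))"
      unfolding piece_def by auto
    then show "y \<in> (\<Union>(a, b). piece E (Suc n) (x(n := a)) (z(n := b)))" by blast
  next
    fix y assume "y \<in> (\<Union>(a, b). piece E (Suc n) (x(n := a)) (z(n := b)))"
    then obtain a b where "y \<in> piece E (Suc n) (x(n := a)) (z(n := b))" by blast
    then obtain w where "(y, w) \<in> E" "\<forall>i<Suc n. y i = (x(n := a)) i \<and> w i = (z(n := b)) i"
      unfolding piece_def by blast
    then show "y \<in> piece E n x z" unfolding piece_def by (auto intro!: exI[of _ w])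
  qed
  have step: "\<exists>t'. bad (Suc n) t' \<and> (case t of (x, z, z') \<Rightarrow>
      \<exists>a b b'. t' = (x(n := a), z(n := b), z'(n := b')))" if "bad n t" for n t
  proof (rule ccontr)
    obtain x z z' where t: "t = (x, z, z')" by (cases t)
    assume *: "\<not> ?thesis"
    have "\<not> bad (Suc n) (x(n := a), z(n := b), z'(n := b'))" for a b b'
      using * unfolding t by auto
    then have good: "borel_separated (piece C (Suc n) (x(n := a)) (z(n := b)))
       (piece C' (Suc n) (x(n := a)) (z'(n := b')))" for a b b'
      unfolding bad_def by simp
    have "borel_separated (piece C (Suc n) (x(n := a)) (z(n := b)))
       (piece C' (Suc n) (x(n := a')) (z'(n := b')))" for a b a' b'
    proof (cases "a = a'")
      case True
      then show ?thesis using good by simp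
    next
      case False
      have "{y :: baire. y n = a} \<in> sets borel" by measurable
      then show ?thesis unfolding borel_separated_def using False
        by (intro bexI[of _ "{y. y n = a}"]) (auto simp: piece_def)
    qed
    then have "borel_separated (piece C n x z) (piece C' n x z')"
      unfolding split[of C n x z] split[of C' n x z'] by (intro borel_separated_UN) auto
    then show False using that by (simp add: bad_def t)
  qed
  have "bad 0 (undefined, undefined, undefined)"
  proof -
    have "piece E 0 x z = fst ` E" for E x z by (force simp: piece_def)
    then show ?thesis using not_sep C C' by (simp add: bad_def)
  qed
  then have "\<exists>f. \<forall>n. bad n (f n) \<and> (case f n of (x, z, z') \<Rightarrow>
      \<exists>a b b'. f (Suc n) = (x(n := a), z(n := b), z'(n := b')))"
  proof (intro dependent_nat_choice)
    fix t n assume "bad n t"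
    then show "\<exists>t'. bad (Suc n) t' \<and> (case t of (x, z, z') \<Rightarrow>
      \<exists>a b b'. t' = (x(n := a), z(n := b), z'(n := b')))" by (rule step)
  qed blast
  then obtain f where f: "\<forall>n. bad n (f n) \<and> (case f n of (x, z, z') \<Rightarrow>
      \<exists>a b b'. f (Suc n) = (x(n := a), z(n := b), z'(n := b')))" by blast
  define p q q' where "p n = fst (f n)" and "q n = fst (snd (f n))" and "q' n = snd (snd (f n))" for n
  have stable: "p (Suc n) i = p n i \<and> q (Suc n) i = q n i \<and> q' (Suc n) i = q' n i" if "i < n" for n i
    using f[rule_format, of n] that by (auto simp: p_def q_def q'_def split: prod.splits)
  define x z z' where "x i = p (Suc i) i" and "z i = q (Suc i) i" and "z' i = q' (Suc i) i" for i
  have limit: "p n i = x i \<and> q n i = z i \<and> q' n i = z' i" if "i < n" for n i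
    using that[unfolded Suc_le_eq[symmetric]]
    by (induction rule: dec_induct) (auto simp: x_def z_def z'_def stable)
  have "\<not> borel_separated (piece C n (p n) (q n)) (piece C' n (p n) (q' n))" for n
    using f[rule_format, of n] by (simp add: bad_def p_def q_def q'_def case_prod_unfold)
  then have ne: "piece C n (p n) (q n) \<noteq> {}" "piece C' n (p n) (q' n) \<noteq> {}" for n
    using borel_separated_empty by metis+
  have "(x, z) \<in> C"
  proof (rule closed_limit_of_approximations[OF C(1)])
    fix n show "\<exists>y w. (y, w) \<in> C \<and> (\<forall>i<n. y i = x i \<and> w i = z i)"
      using ne(1)[of n] limit unfolding piece_def by auto
  qed
  moreover have "(x, z') \<in> C'"
  proof (rule closed_limit_of_approximations[OF C'(1)])
    fix n show "\<exists>y w. (y, w) \<in> C' \<and> (\<forall>i<n. y i = x i \<and> w i = z' i)"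
      using ne(2)[of n] limit unfolding piece_def by auto
  qed
  ultimately have "x \<in> A \<inter> A'" unfolding C C' by force
  then show False using assms(3) by blast
qed

section \<open>Bounded-to-one Borel images\<close>

text \<open>
  The Lusin--Souslin theorem. By injectivity, the images of the points of \<open>Q\<close> whose digit at \<open>m\<close> is
  \<open>a\<close> and of those with another digit there are disjoint analytic sets, so a Borel set \<open>C m a\<close> separates them.
  The sets \<open>C m a\<close> determine on \<open>F ` Q\<close> the digits of the preimage, which yields a Borel function \<open>h\<close>,
  defined everywhere, that inverts \<open>F\<close> on the image. The image is then described by \<open>h\<close> without a
  quantifier over points.
\<close>

lemma borel_image_inj_on:
  fixes F :: "baire \<Rightarrow> baire"
  assumes [measurable]: "Q \<in> sets borel" "F \<in> borel_measurable borel" and "inj_on F Q"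
  shows "F ` Q \<in> sets borel"
proof -
  have "borel_separated (F ` (Q \<inter> {x. x m = a})) (F ` (Q \<inter> {x. x m \<noteq> a}))" for m a
    using assms(3) by (intro analytic_separation analytic_image) (auto dest: inj_onD)
  then obtain C where [measurable]: "\<And>m a. C m a \<in> sets borel"
    and C: "\<And>m a. F ` (Q \<inter> {x. x m = a}) \<subseteq> C m a"
      "\<And>m a. C m a \<inter> F ` (Q \<inter> {x. x m \<noteq> a}) = {}"
    unfolding borel_separated_def by metis
  define h :: "baire \<Rightarrow> baire" where "h y = (\<lambda>m. LEAST a. y \<in> C m a)" for y
  have [measurable]: "h \<in> borel_measurable borel"
    unfolding h_def by (intro measurable_baireI) measurable
  have h: "h (F x) = x" if "x \<in> Q" for x
  proof (rule ext)
    fix m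
    show "h (F x) m = x m"
      unfolding h_def by (rule Least_equality) (use C that in blast)+
  qed
  have "F ` Q = {y. h y \<in> Q \<and> F (h y) = y}"
    using h by (force simp: image_iff)
  also have "\<dots> \<in> sets borel" by measurable
  finally show ?thesis .
qed

definition lex_less :: "baire \<Rightarrow> baire \<Rightarrow> bool" where
  "lex_less x y \<longleftrightarrow> (\<exists>m. (\<forall>i<m. x i = y i) \<and> x m < y m)"

lemma lex_less_irrefl: "\<not> lex_less x x"
  by (simp add: lex_less_def)

lemma lex_less_trans:
  assumes "lex_less x y" "lex_less y z"
  shows "lex_less x z"
proof -
  obtain m n where m: "\<And>i. i < m \<Longrightarrow> x i = y i" "x m < y m"
    and n: "\<And>i. i < n \<Longrightarrow> y i = z i" "y n < z n"
    using assms unfolding lex_less_def by blast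
  have "\<forall>i < min m n. x i = z i" using m(1) n(1) by simp
  moreover have "x (min m n) < z (min m n)"
  proof (cases m n rule: linorder_cases)
    case less
    then show ?thesis using m(2) n(1)[of m] by simp
  next
    case equal
    then show ?thesis using m(2) n(2) by simp
  next
    case greater
    then show ?thesis using n(2) m(1)[of n] by simp
  qed
  ultimately show ?thesis unfolding lex_less_def by blast
qed

lemma lex_less_total:
  assumes "x \<noteq> y"
  shows "lex_less x y \<or> lex_less y x"
proof -
  define m where "m = (LEAST m. x m \<noteq> y m)"
  have "\<exists>m. x m \<noteq> y m" using assms by (auto simp: fun_eq_iff)
  then have "x m \<noteq> y m" unfolding m_def by (rule LeastI_ex)
  moreover have "x i = y i" if "i < m" for i
    using that not_less_Least unfolding m_def by blast
  ultimately show ?thesis unfolding lex_less_def by (metis linorder_neqE_nat)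
qed

lemma measurable_lex_less [measurable]:
  assumes [measurable]: "f \<in> borel_measurable M" "g \<in> borel_measurable M"
  shows "Measurable.pred M (\<lambda>x. lex_less (f x) (g x))"
proof -
  have [measurable]: "(\<lambda>x. f x i) \<in> measurable M (count_space UNIV)"
    "(\<lambda>x. g x i) \<in> measurable M (count_space UNIV)" for i
    using measurable_compose[OF assms(1) measurable_coordinate]
      measurable_compose[OF assms(2) measurable_coordinate] by blast+
  have "(\<lambda>x. lex_less (f x) (g x)) = (\<lambda>x. \<exists>m. (\<forall>i<m. \<exists>n. f x i = n \<and> g x i = n) \<and>
     (\<exists>a b. a < b \<and> f x m = a \<and> g x m = b))"
    unfolding lex_less_def by simp metis
  then show ?thesis by (simp only:) measurable
qed

lemma finite_lex_maximal:
  assumes "finite S" "S \<noteq> {}"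
  obtains x where "x \<in> S" "\<And>x'. x' \<in> S \<Longrightarrow> \<not> lex_less x x'"
  using assms
proof (induction arbitrary: thesis rule: finite_ne_induct)
  case (singleton x)
  then show ?case using lex_less_irrefl by blast
next
  case (insert x S)
  obtain y where y: "y \<in> S" "\<And>x'. x' \<in> S \<Longrightarrow> \<not> lex_less y x'"
    using insert.IH by blast
  show ?case
  proof (cases "lex_less y x")
    case True
    then show ?thesis using y lex_less_trans lex_less_irrefl insert.prems[of x] by blast
  next
    case False
    then show ?thesis using y insert.prems[of y] by blast
  qed
qed

text \<open>
  By injectivity on the lexicographically largest points of the fibres, the claim reduces to these points
  forming a Borel set. Their complement in \<open>Q\<close> consists of the first components of the pairs
  \<open>(x, x')\<close> in \<open>Q\<close> with \<open>F x = F x'\<close> and \<open>x\<close> smaller than \<open>x'\<close>. It is the image of a Borel set under a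
  map for which the bound on the fibres is smaller by one, because \<open>x\<close> itself does not occur as an \<open>x'\<close>.
\<close>

theorem borel_image_bounded_to_one:
  fixes F :: "baire \<Rightarrow> baire"
  assumes "Q \<in> sets borel" "F \<in> borel_measurable borel"
    and "\<And>y. finite {x \<in> Q. F x = y}" "\<And>y. card {x \<in> Q. F x = y} \<le> k"
  shows "F ` Q \<in> sets borel"
  using assms
proof (induction k arbitrary: Q F)
  case 0
  then have "Q = {}" by auto
  then show ?case by simp
next
  case (Suc k)
  note [measurable] = Suc.prems(1,2)
  define R where "R = {u. left u \<in> Q \<and> right u \<in> Q \<and> lex_less (left u) (right u) \<and>
    F (left u) = F (right u)}"
  have R [measurable]: "R \<in> sets borel" unfolding R_def by measurable
  have fibre: "finite {u \<in> R. left u = x}" "card {u \<in> R. left u = x} \<le> k" for x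
  proof -
    let ?S = "{x' \<in> Q. F x' = F x}"
    have sub: "{u \<in> R. left u = x} \<subseteq> join x ` (?S - {x})"
    proof
      fix u assume "u \<in> {u \<in> R. left u = x}"
      then show "u \<in> join x ` (?S - {x})"
        by (intro image_eqI[of _ _ "right u"]) (auto simp: R_def lex_less_irrefl)
    qed
    have fin: "finite ?S" by (rule Suc.prems(3))
    then show "finite {u \<in> R. left u = x}" using sub by (meson finite_Diff finite_imageI finite_subset)
    show "card {u \<in> R. left u = x} \<le> k"
    proof (cases "x \<in> Q")
      case True
      have "card {u \<in> R. left u = x} \<le> card (?S - {x})"
        using sub fin by (meson card_image_le card_mono finite_Diff finite_imageI le_trans)
      also have "\<dots> = card ?S - 1" using True by (intro card_Diff_singleton) auto
      also have "\<dots> \<le> k" using Suc.prems(4)[of "F x"] by simp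
      finally show ?thesis .
    next
      case False
      then have "{u \<in> R. left u = x} = {}" by (auto simp: R_def)
      then show ?thesis by (simp only: card.empty)
    qed
  qed
  have "left ` R \<in> sets borel"
    by (rule Suc.IH) (use R fibre in \<open>auto\<close>)
  then have "Q - left ` R \<in> sets borel" by measurable
  moreover have "inj_on F (Q - left ` R)"
  proof (rule inj_onI, rule ccontr)
    fix x y assume *: "x \<in> Q - left ` R" "y \<in> Q - left ` R" "F x = F y" "x \<noteq> y"
    then have "join x y \<in> R \<or> join y x \<in> R" using lex_less_total[of x y] by (auto simp: R_def)
    then have "x \<in> left ` R \<or> y \<in> left ` R" by (metis imageI left_join)
    then show False using * by blast
  qed
  ultimately have "F ` (Q - left ` R) \<in> sets borel" by (intro borel_image_inj_on) auto
  moreover have "F ` (Q - left ` R) = F ` Q"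
  proof (intro equalityI subsetI)
    fix y assume "y \<in> F ` Q"
    then have "{x \<in> Q. F x = y} \<noteq> {}" by blast
    then obtain x where x: "x \<in> {x \<in> Q. F x = y}"
      "\<And>x'. x' \<in> {x \<in> Q. F x = y} \<Longrightarrow> \<not> lex_less x x'"
      using finite_lex_maximal[OF Suc.prems(3)[of y]] by blast
    then have "x \<notin> left ` R" by (auto simp: R_def)
    then show "y \<in> F ` (Q - left ` R)" using x by blast
  qed auto
  ultimately show ?case by simp
qed


section \<open>Standard Borel spaces as Borel retracts of the Baire space\<close>

definition baire_retraction :: "'a measure \<Rightarrow> ('a \<Rightarrow> baire) \<Rightarrow> (baire \<Rightarrow> 'a) \<Rightarrow> bool" where
  "baire_retraction M \<sigma> h \<longleftrightarrow>
     \<sigma> \<in> borel_measurable M \<and> h \<in> measurable borel M \<and> (\<forall>x\<in>space M. h (\<sigma> x) = x)"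

text \<open>
  Fix a complete metric and a dense sequence \<open>e\<close>. A point \<open>x\<close> is coded by the sequence \<open>\<sigma> x\<close> whose \<open>m\<close>-th
  entry is the first index of a member of \<open>e\<close> at distance less than \<open>1 / 2 ^ m\<close> from \<open>x\<close>. Conversely, \<open>h\<close> maps
  a sequence of indices to the limit of the corresponding points, provided that consecutive ones are
  as close as those of a code must be; by completeness the limit exists.
\<close>

lemma standard_borel_baire_retraction:
  assumes "standard_borel M" "space M \<noteq> {}"
  shows "\<exists>\<sigma> h. baire_retraction M \<sigma> h"
proof -
  obtain T where T: "completely_metrizable_space T" "separable_space T" "topspace T = space M"
    "sets M = sigma_sets (space M) {U. openin T U}"
    using assms(1) unfolding standard_borel_def by blast
  obtain X d where X: "Metric_space X d" "Metric_space.mcomplete X d"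
    "T = Metric_space.mtopology X d"
    using T(1) unfolding completely_metrizable_space_def by blast
  interpret Metric_space X d by (rule X(1))
  have space_M: "space M = X" using T(3) X(3) by simp
  have open_sets: "U \<in> sets M" if "openin mtopology U" for U
    using that T(4) X(3) by auto
  obtain x0 where x0: "x0 \<in> X" using assms(2) space_M by blast
  obtain D where D: "countable D" "D \<subseteq> X" "mtopology closure_of D = X"
    using T(2,3) X(3) unfolding separable_space_def by auto
  have "D \<noteq> {}" using D(3) x0 by auto
  define e where "e = from_nat_into D"
  have range_e: "range e = D" unfolding e_def using D(1) \<open>D \<noteq> {}\<close> by (rule range_from_nat_into[rotated])
  then have eX [simp]: "e j \<in> X" for j using D(2) by blast
  have dense: "\<exists>j. d x (e j) < r" if x: "x \<in> X" and r: "r > 0" for x r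
  proof -
    have "x \<in> mtopology closure_of D" using D(3) x by simp
    then obtain y where "y \<in> D" "y \<in> mball x r"
      using r unfolding metric_closure_of by blast
    then show ?thesis using range_e by (metis in_mball imageE)
  qed
  define \<sigma> :: "'a \<Rightarrow> baire" where "\<sigma> x = (\<lambda>m. LEAST j. d x (e j) < (1/2) ^ m)" for x
  have \<sigma>: "d x (e (\<sigma> x m)) < (1/2) ^ m" if "x \<in> X" for x m
    unfolding \<sigma>_def by (rule LeastI_ex) (simp add: dense that)
  have [measurable]: "Measurable.pred M (\<lambda>x. d x (e j) < r)" for j r
  proof -
    have "{x \<in> space M. d x (e j) < r} = mball (e j) r"
      by (auto simp: space_M commute)
    then show ?thesis using open_sets[OF openin_mball] by (simp add: pred_def)
  qed
  have \<sigma>_meas: "\<sigma> \<in> borel_measurable M"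
    unfolding \<sigma>_def by (intro measurable_baireI) measurable
  define K where "K = {\<alpha> :: baire. \<forall>m. d (e (\<alpha> m)) (e (\<alpha> (Suc m))) < 2 * (1/2) ^ m}"
  \<comment> \<open>the bound is the sum of the distances \<open>2 / 2 ^ k\<close> of consecutive points for \<open>k \<ge> m\<close>\<close>
  define near where "near \<alpha> l \<longleftrightarrow> l \<in> X \<and> (\<forall>m. d (e (\<alpha> m)) l \<le> 4 * (1/2) ^ m)" for \<alpha> :: baire and l
  have \<sigma>_K: "\<sigma> x \<in> K" if "x \<in> X" for x
  proof -
    have "d (e (\<sigma> x m)) (e (\<sigma> x (Suc m))) < 2 * (1/2) ^ m" for m
    proof -
      have "d (e (\<sigma> x m)) (e (\<sigma> x (Suc m))) \<le> d x (e (\<sigma> x m)) + d x (e (\<sigma> x (Suc m)))"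
        using that by (metis commute eX triangle)
      also have "\<dots> < (1/2) ^ m + (1/2) ^ Suc m" using \<sigma>[OF that] by (intro add_strict_mono)
      also have "\<dots> \<le> 2 * (1/2) ^ m" by simp
      finally show ?thesis .
    qed
    then show ?thesis by (simp add: K_def)
  qed
  have near_ex: "\<exists>l. near \<alpha> l" if "\<alpha> \<in> K" for \<alpha>
  proof -
    have tail: "d (e (\<alpha> m)) (e (\<alpha> (m + k))) \<le> 4 * (1/2) ^ m - 4 * (1/2) ^ (m + k)" for m k
    proof (induction k)
      case (Suc k)
      have "d (e (\<alpha> m)) (e (\<alpha> (m + Suc k))) \<le>
          d (e (\<alpha> m)) (e (\<alpha> (m + k))) + d (e (\<alpha> (m + k))) (e (\<alpha> (Suc (m + k))))"
        by (simp add: triangle)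
      moreover have "d (e (\<alpha> (m + k))) (e (\<alpha> (Suc (m + k)))) < 2 * (1/2) ^ (m + k)"
        using that by (simp add: K_def)
      ultimately show ?case using Suc.IH by simp
    qed simp
    have small: "\<exists>N. 4 * (1/2 :: real) ^ N < \<epsilon>" if "\<epsilon> > 0" for \<epsilon>
      using real_arch_pow_inv[of "\<epsilon> / 4" "1/2"] that by (auto simp: field_simps)
    have tail': "d (e (\<alpha> m)) (e (\<alpha> n)) \<le> 4 * (1/2) ^ m" if "m \<le> n" for m n
      using tail[of m "n - m"] that by (smt (verit) le_add_diff_inverse zero_le_power divide_nonneg_nonneg)
    have "MCauchy (\<lambda>m. e (\<alpha> m))"
      unfolding MCauchy_def
    proof (intro conjI allI impI)
      fix \<epsilon> :: real assume "\<epsilon> > 0"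
      then obtain N where N: "4 * (1/2 :: real) ^ N < \<epsilon> / 2" using small[of "\<epsilon> / 2"] by auto
      have "d (e (\<alpha> n)) (e (\<alpha> n')) < \<epsilon>" if "N \<le> n" "N \<le> n'" for n n'
      proof -
        have "d (e (\<alpha> n)) (e (\<alpha> n')) \<le> d (e (\<alpha> N)) (e (\<alpha> n)) + d (e (\<alpha> N)) (e (\<alpha> n'))"
          by (metis commute eX triangle)
        then show ?thesis using tail'[OF that(1)] tail'[OF that(2)] N by linarith
      qed
      then show "\<exists>N. \<forall>n n'. N \<le> n \<longrightarrow> N \<le> n' \<longrightarrow> d (e (\<alpha> n)) (e (\<alpha> n')) < \<epsilon>" by blast
    qed auto
    then obtain l where l: "limitin mtopology (\<lambda>m. e (\<alpha> m)) l sequentially"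
      using X(2) unfolding mcomplete_def by blast
    then have lX: "l \<in> X" by (simp add: limitin_mspace)
    have "d (e (\<alpha> m)) l \<le> 4 * (1/2) ^ m" for m
    proof (rule field_le_epsilon)
      fix \<epsilon> :: real assume "\<epsilon> > 0"
      then obtain N where "\<And>n. n \<ge> N \<Longrightarrow> d (e (\<alpha> n)) l < \<epsilon>"
        using l unfolding limit_metric_sequentially by blast
      then have "d (e (\<alpha> (max m N))) l < \<epsilon>" by simp
      moreover have "d (e (\<alpha> m)) l \<le> d (e (\<alpha> m)) (e (\<alpha> (max m N))) + d (e (\<alpha> (max m N))) l"
        using lX by (simp add: triangle)
      ultimately show "d (e (\<alpha> m)) l \<le> 4 * (1/2) ^ m + \<epsilon>" using tail'[of m "max m N"] by simp
    qed
    then show ?thesis using lX by (auto simp: near_def)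
  qed
  define h where "h \<alpha> = (if \<alpha> \<in> K then SOME l. near \<alpha> l else x0)" for \<alpha>
  have near_h: "near \<alpha> (h \<alpha>)" if "\<alpha> \<in> K" for \<alpha>
    using someI_ex[OF near_ex[OF that]] that by (simp add: h_def)
  have hX: "h \<alpha> \<in> X" for \<alpha>
    using near_h[of \<alpha>] x0 by (cases "\<alpha> \<in> K") (auto simp: h_def near_def)
  have h_\<sigma>: "h (\<sigma> x) = x" if x: "x \<in> X" for x
  proof (rule ccontr)
    assume "h (\<sigma> x) \<noteq> x"
    then have "d x (h (\<sigma> x)) > 0" using x hX by (simp add: mdist_pos_less)
    then obtain m where m: "(1/2 :: real) ^ m < d x (h (\<sigma> x)) / 5"
      using real_arch_pow_inv[of "d x (h (\<sigma> x)) / 5" "1/2"] by auto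
    have "d x (h (\<sigma> x)) \<le> d x (e (\<sigma> x m)) + d (e (\<sigma> x m)) (h (\<sigma> x))"
      using x hX by (intro triangle) auto
    moreover have "d (e (\<sigma> x m)) (h (\<sigma> x)) \<le> 4 * (1/2) ^ m"
      using near_h[OF \<sigma>_K[OF x]] by (simp add: near_def)
    ultimately show False using \<sigma>[OF x, of m] m by linarith
  qed
  have K_meas: "K \<in> sets borel" unfolding K_def
  proof -
    have "Measurable.pred borel (\<lambda>\<alpha> :: baire. d (e (\<alpha> m)) (e (\<alpha> (Suc m))) < 2 * (1/2) ^ m)" for m
    proof -
      have "(\<lambda>\<alpha> :: baire. d (e (\<alpha> m)) (e (\<alpha> (Suc m))) < 2 * (1/2) ^ m) =
        (\<lambda>\<alpha>. \<exists>a b. d (e a) (e b) < 2 * (1/2) ^ m \<and> \<alpha> m = a \<and> \<alpha> (Suc m) = b)" by auto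
      then show ?thesis by (simp only:) measurable
    qed
    then show "{\<alpha> :: baire. \<forall>m. d (e (\<alpha> m)) (e (\<alpha> (Suc m))) < 2 * (1/2) ^ m} \<in> sets borel"
      by measurable
  qed
  have "h \<in> measurable borel M"
  proof (rule measurable_sigma_sets[OF T(4)])
    show "{U. openin T U} \<subseteq> Pow (space M)" using T(3) openin_subset by blast
    show "h \<in> space borel \<rightarrow> space M" using hX space_M by auto
    fix U assume "U \<in> {U. openin T U}"
    then have U: "openin mtopology U" using X(3) by simp
    define G where "G = {\<alpha> :: baire. \<exists>m. mcball (e (\<alpha> m)) (4 * (1/2) ^ m) \<subseteq> U}"
    have "G = {\<alpha> :: baire. \<exists>m a. mcball (e a) (4 * (1/2) ^ m) \<subseteq> U \<and> \<alpha> m = a}"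
      unfolding G_def by auto
    also have "\<dots> \<in> sets borel" by measurable
    finally have G: "G \<in> sets borel" .
    have "h \<alpha> \<in> U \<longleftrightarrow> \<alpha> \<in> G" if \<alpha>K: "\<alpha> \<in> K" for \<alpha>
    proof
      assume "h \<alpha> \<in> U"
      then obtain r where r: "r > 0" "mball (h \<alpha>) r \<subseteq> U" using U unfolding openin_mtopology by blast
      obtain m where m: "(1/2 :: real) ^ m < r / 8" using real_arch_pow_inv[of "r / 8" "1/2"] r by auto
      have "y \<in> mball (h \<alpha>) r" if y: "y \<in> mcball (e (\<alpha> m)) (4 * (1/2) ^ m)" for y
      proof -
        have "d (h \<alpha>) y \<le> d (e (\<alpha> m)) (h \<alpha>) + d (e (\<alpha> m)) y"
          using y hX by (metis commute eX in_mcball triangle)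
        moreover have "d (e (\<alpha> m)) (h \<alpha>) \<le> 4 * (1/2) ^ m"
          using near_h[OF \<alpha>K] by (simp add: near_def)
        moreover have "y \<in> X" "d (e (\<alpha> m)) y \<le> 4 * (1/2) ^ m" using y by auto
        ultimately have "d (h \<alpha>) y < r" using m by linarith
        then show ?thesis using \<open>y \<in> X\<close> hX by simp
      qed
      then show "\<alpha> \<in> G" using r(2) unfolding G_def by blast
    next
      assume "\<alpha> \<in> G"
      then show "h \<alpha> \<in> U" using near_h[OF \<alpha>K] unfolding G_def near_def by auto
    qed
    then have "h -` U \<inter> space borel = K \<inter> G \<union> (if x0 \<in> U then - K else {})"
      by (auto simp: h_def split: if_splits)
    then show "h -` U \<inter> space borel \<in> sets borel" using K_meas G by auto
  qed
  then show ?thesis using \<sigma>_meas h_\<sigma> space_M unfolding baire_retraction_def by blast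
qed

text \<open>
  The codes of the entries of a tuple are interleaved by the pairing function.
\<close>

lemma baire_retraction_PiM:
  assumes "baire_retraction M \<sigma> h"
  shows "\<exists>\<sigma>' h'. baire_retraction (PiM {..<n :: nat} (\<lambda>_. M)) \<sigma>' h'"
proof -
  have [measurable]: "\<sigma> \<in> borel_measurable M" "h \<in> measurable borel M"
    and h\<sigma>: "\<And>x. x \<in> space M \<Longrightarrow> h (\<sigma> x) = x"
    using assms by (auto simp: baire_retraction_def)
  define c :: "(nat \<Rightarrow> 'a) \<Rightarrow> baire" where
    "c x = (\<lambda>k. if fst (prod_decode k) < n then \<sigma> (x (fst (prod_decode k))) (snd (prod_decode k)) else 0)" for x
  define r where "r \<alpha> = (\<lambda>i\<in>{..<n}. h (\<lambda>m. \<alpha> (prod_encode (i, m))))" for \<alpha> :: baire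
  have "c \<in> borel_measurable (PiM {..<n} (\<lambda>_. M))"
  proof (rule measurable_baireI)
    fix k
    show "(\<lambda>x. c x k) \<in> measurable (PiM {..<n} (\<lambda>_. M)) (count_space UNIV)"
    proof (cases "fst (prod_decode k) < n")
      case True
      then have "(\<lambda>x. \<sigma> (x (fst (prod_decode k)))) \<in> borel_measurable (PiM {..<n} (\<lambda>_. M))"
        by (intro measurable_compose[OF measurable_component_singleton]) auto
      from measurable_compose[OF this measurable_coordinate] show ?thesis
        using True by (simp add: c_def)
    qed (simp add: c_def)
  qed
  moreover have "r \<in> measurable borel (PiM {..<n} (\<lambda>_. M))"
    unfolding r_def
  proof (rule measurable_restrict)
    fix i
    have "(\<lambda>\<alpha> :: baire. (\<lambda>m. \<alpha> (prod_encode (i, m)))) \<in> borel_measurable borel"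
      by (intro measurable_baireI) measurable
    then show "(\<lambda>\<alpha>. h (\<lambda>m. \<alpha> (prod_encode (i, m)))) \<in> measurable borel M"
      by (rule measurable_compose) measurable
  qed
  moreover have "r (c x) = x" if "x \<in> space (PiM {..<n} (\<lambda>_. M))" for x
  proof
    fix i
    show "r (c x) i = x i"
    proof (cases "i < n")
      case True
      then have "x i \<in> space M" using that by (auto simp: space_PiM)
      then show ?thesis using True h\<sigma> by (simp add: r_def c_def)
    next
      case False
      then show ?thesis using that by (auto simp: r_def space_PiM PiE_def extensional_def)
    qed
  qed
  ultimately show ?thesis unfolding baire_retraction_def by blast
qed

text \<open>
  Replacing \<open>Q\<close> by the set of codes of its points preserves the sizes of the fibres; the codes form a
  Borel set because they are the fixed points of \<open>\<sigma> \<circ> h\<close>.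
\<close>

lemma baire_retraction_image_bounded_to_one:
  assumes "baire_retraction M \<sigma> h" "baire_retraction N \<sigma>' h'"
    and [measurable]: "Q \<in> sets M" "F \<in> measurable M N"
    and fibres: "\<And>y. y \<in> space N \<Longrightarrow> finite {x \<in> Q. F x = y} \<and> card {x \<in> Q. F x = y} \<le> k"
  shows "F ` Q \<in> sets N"
proof -
  have [measurable]: "\<sigma> \<in> borel_measurable M" "h \<in> measurable borel M"
    "\<sigma>' \<in> borel_measurable N" "h' \<in> measurable borel N"
    and h\<sigma>: "\<And>x. x \<in> space M \<Longrightarrow> h (\<sigma> x) = x" "\<And>x. x \<in> space N \<Longrightarrow> h' (\<sigma>' x) = x"
    using assms by (auto simp: baire_retraction_def)
  have Q: "x \<in> space M" if "x \<in> Q" for x using that sets.sets_into_space[OF assms(3)] by blast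
  have F: "F x \<in> space N" if "x \<in> Q" for x using Q[OF that] measurable_space[OF assms(4)] by blast
  define Q' where "Q' = {\<alpha>. h \<alpha> \<in> Q \<and> \<sigma> (h \<alpha>) = \<alpha>}"
  define F' where "F' \<alpha> = \<sigma>' (F (h \<alpha>))" for \<alpha>
  have Q'_meas: "Q' \<in> sets borel" unfolding Q'_def by measurable
  have F'_meas: "F' \<in> borel_measurable borel" unfolding F'_def by measurable
  have fibre: "{\<alpha> \<in> Q'. F' \<alpha> = \<beta>} \<subseteq> \<sigma> ` {x \<in> Q. F x = h' \<beta>}" for \<beta>
    using h\<sigma> F by (force simp: Q'_def F'_def)
  have h'N: "h' \<beta> \<in> space N" for \<beta>
    using measurable_space[of h' borel N \<beta>] by simp
  have "F' ` Q' \<in> sets borel"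
  proof (rule borel_image_bounded_to_one[OF Q'_meas F'_meas])
    fix \<beta>
    have fin: "finite (\<sigma> ` {x \<in> Q. F x = h' \<beta>})" using fibres[OF h'N] by blast
    then show "finite {\<alpha> \<in> Q'. F' \<alpha> = \<beta>}" using fibre by (rule finite_subset[rotated])
    have "card {\<alpha> \<in> Q'. F' \<alpha> = \<beta>} \<le> card (\<sigma> ` {x \<in> Q. F x = h' \<beta>})"
      by (rule card_mono[OF fin fibre])
    also have "\<dots> \<le> card {x \<in> Q. F x = h' \<beta>}" using fibres[OF h'N] by (intro card_image_le) blast
    finally show "card {\<alpha> \<in> Q'. F' \<alpha> = \<beta>} \<le> k" using fibres[OF h'N, of \<beta>] by linarith
  qed
  then have "{y \<in> space N. \<sigma>' y \<in> F' ` Q'} \<in> sets N" by measurable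
  also have "{y \<in> space N. \<sigma>' y \<in> F' ` Q'} = F ` Q"
  proof (intro set_eqI iffI)
    fix y assume "y \<in> F ` Q"
    then obtain x where x: "x \<in> Q" "y = F x" by blast
    then have "\<sigma> x \<in> Q'" "\<sigma>' y = F' (\<sigma> x)" using Q h\<sigma> by (auto simp: Q'_def F'_def)
    then show "y \<in> {y \<in> space N. \<sigma>' y \<in> F' ` Q'}" using x F by blast
  next
    fix y assume "y \<in> {y \<in> space N. \<sigma>' y \<in> F' ` Q'}"
    then obtain \<alpha> where "y \<in> space N" "h \<alpha> \<in> Q" "\<sigma>' y = \<sigma>' (F (h \<alpha>))"
      by (auto simp: Q'_def F'_def)
    then show "y \<in> F ` Q" using h\<sigma>(2) F by (metis imageI)
  qed
  finally show ?thesis .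
qed

theorem standard_borel_projection_bounded_to_one:
  assumes "standard_borel M" "Q \<in> sets (PiM {..<n :: nat} (\<lambda>_. M))" "i < n"
    and "\<And>x. x \<in> space M \<Longrightarrow> finite {t \<in> Q. t i = x} \<and> card {t \<in> Q. t i = x} \<le> k"
  shows "(\<lambda>t. t i) ` Q \<in> sets M"
proof (cases "space M = {}")
  case True
  then have "space (PiM {..<n} (\<lambda>_. M)) = {}"
    using assms(3) by (auto simp: space_PiM PiE_eq_empty_iff)
  then have "Q = {}" using sets.sets_into_space[OF assms(2)] by blast
  then show ?thesis by simp
next
  case False
  then obtain \<sigma> h where "baire_retraction M \<sigma> h"
    using standard_borel_baire_retraction[OF assms(1)] by blast
  moreover then obtain \<sigma>' h' where "baire_retraction (PiM {..<n} (\<lambda>_. M)) \<sigma>' h'"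
    using baire_retraction_PiM by blast
  ultimately show ?thesis
    using assms by (intro baire_retraction_image_bounded_to_one) auto
qed


section \<open>The local lemma for finitely many events\<close>

text \<open>
  Independence of two events that depend on disjoint sets of coordinates. Exchanging the coordinates in
  \<open>J\<close> between two functions is an involution of \<open>\<Omega> \<times> \<Omega>\<close>, and it turns the pairs with \<open>P\<close> for the first
  and \<open>P'\<close> for the second function into the pairs in which one function satisfies both and the
  other one is arbitrary.
\<close>

lemma card_independent:
  fixes C J :: "'v set" and Q :: "'c set" and P P' :: "('v \<Rightarrow> 'c) \<Rightarrow> bool"
  assumes "J \<subseteq> C"
    and P: "\<And>g g'. (\<And>x. x \<in> J \<Longrightarrow> g x = g' x) \<Longrightarrow> P g \<Longrightarrow> P g'"
    and P': "\<And>g g'. (\<And>x. x \<in> C - J \<Longrightarrow> g x = g' x) \<Longrightarrow> P' g \<Longrightarrow> P' g'"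
    and \<Omega>_def: "\<Omega> = PiE C (\<lambda>_. Q)"
  shows "card {g \<in> \<Omega>. P g \<and> P' g} * card \<Omega> = card {g \<in> \<Omega>. P g} * card {g \<in> \<Omega>. P' g}"
proof -
  define sw where "sw = (\<lambda>(g :: 'v \<Rightarrow> 'c, g' :: 'v \<Rightarrow> 'c). (override_on g' g J, override_on g g' J))"
  have "bij_betw sw ({g \<in> \<Omega>. P g} \<times> {g \<in> \<Omega>. P' g}) ({g \<in> \<Omega>. P g \<and> P' g} \<times> \<Omega>)"
  proof (rule bij_betw_byWitness[where f' = sw])
    have sw_sw: "sw (sw p) = p" for p
      by (cases p) (auto simp: sw_def override_on_def fun_eq_iff)
    then show "\<forall>p\<in>{g \<in> \<Omega>. P g} \<times> {g \<in> \<Omega>. P' g}. sw (sw p) = p"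
      "\<forall>p\<in>{g \<in> \<Omega>. P g \<and> P' g} \<times> \<Omega>. sw (sw p) = p" by blast+
    have \<Omega>: "override_on g g' J \<in> \<Omega>" if "g \<in> \<Omega>" "g' \<in> \<Omega>" for g g'
      using that assms(1) by (fastforce simp: \<Omega>_def override_on_def PiE_iff extensional_def)
    have P_iff: "P (override_on g' g J) = P g" for g g'
      using P[of g "override_on g' g J"] P[of "override_on g' g J" g] by auto
    have P'_iff: "P' (override_on g' g J) = P' g'" for g g'
      using P'[of g' "override_on g' g J"] P'[of "override_on g' g J" g'] by auto
    show "sw ` ({g \<in> \<Omega>. P g} \<times> {g \<in> \<Omega>. P' g}) \<subseteq> {g \<in> \<Omega>. P g \<and> P' g} \<times> \<Omega>"
      using \<Omega> P_iff P'_iff by (auto simp: sw_def)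
    show "sw ` ({g \<in> \<Omega>. P g \<and> P' g} \<times> \<Omega>) \<subseteq> {g \<in> \<Omega>. P g} \<times> {g \<in> \<Omega>. P' g}"
      using \<Omega> P_iff P'_iff by (auto simp: sw_def)
  qed
  from bij_betw_same_card[OF this] show ?thesis by (simp add: card_cartesian_product)
qed

text \<open>
  The usual induction: for a set \<open>S\<close> of events, the probability of \<open>A i\<close> conditioned on avoiding \<open>S\<close> is
  at most \<open>x\<close>. Split \<open>S\<close> into the events \<open>S1\<close> that share variables with \<open>A i\<close> and the others, \<open>S2\<close>. The
  event \<open>A i\<close> is independent of \<open>S2\<close>, and by the induction hypothesis, given that \<open>S2\<close> is avoided, all of
  \<open>S1\<close> is avoided with probability at least \<open>(1 - x)\<^sup>d\<close>; this factor is compensated by the hypothesis on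
  the probability of \<open>A i\<close>. Counts of functions take the place of probabilities: \<open>N S\<close> is the number of
  functions that avoid \<open>S\<close>, and \<open>L i S\<close> the number of those among them for which \<open>A i\<close> occurs.
\<close>

theorem finite_local_lemma:
  fixes C :: "'v set" and Q :: "'c set" and I :: "'i set" and A :: "'i \<Rightarrow> ('v \<Rightarrow> 'c) \<Rightarrow> bool"
    and vars :: "'i \<Rightarrow> 'v set" and x :: real
  assumes fin: "finite C" "finite Q" "Q \<noteq> {}" "finite I"
    and vars: "\<And>i. i \<in> I \<Longrightarrow> vars i \<subseteq> C"
    and dep: "\<And>i g g'. i \<in> I \<Longrightarrow> (\<And>v. v \<in> vars i \<Longrightarrow> g v = g' v) \<Longrightarrow> A i g \<Longrightarrow> A i g'"
    and deg: "\<And>i. i \<in> I \<Longrightarrow> card {j \<in> I. j \<noteq> i \<and> vars j \<inter> vars i \<noteq> {}} \<le> d"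
    and x: "0 \<le> x" "x < 1"
    and prob: "\<And>i. i \<in> I \<Longrightarrow> real (card {g \<in> PiE C (\<lambda>_. Q). A i g}) \<le>
        x * (1 - x) ^ d * real (card (PiE C (\<lambda>_. Q)))"
  shows "\<exists>g \<in> PiE C (\<lambda>_. Q). \<forall>i\<in>I. \<not> A i g"
proof -
  define \<Omega> where "\<Omega> = PiE C (\<lambda>_. Q)"
  have fin\<Omega>: "finite \<Omega>" unfolding \<Omega>_def using fin by (intro finite_PiE) auto
  have "\<Omega> \<noteq> {}" unfolding \<Omega>_def using fin(3) by (simp add: PiE_eq_empty_iff)
  then have pos\<Omega>: "card \<Omega> > 0" using fin\<Omega> by (simp add: card_gt_0_iff)
  define N where "N S = real (card {g \<in> \<Omega>. \<forall>j\<in>S. \<not> A j g})" for S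
  define L where "L i S = real (card {g \<in> \<Omega>. A i g \<and> (\<forall>j\<in>S. \<not> A j g)})" for i S
  have N_insert: "N S = N (insert i S) + L i S" for i S
  proof -
    have "card ({g \<in> \<Omega>. \<forall>j\<in>insert i S. \<not> A j g} \<union> {g \<in> \<Omega>. A i g \<and> (\<forall>j\<in>S. \<not> A j g)}) =
      card {g \<in> \<Omega>. \<forall>j\<in>insert i S. \<not> A j g} + card {g \<in> \<Omega>. A i g \<and> (\<forall>j\<in>S. \<not> A j g)}"
      using fin\<Omega> by (intro card_Un_disjoint) auto
    moreover have "{g \<in> \<Omega>. \<forall>j\<in>insert i S. \<not> A j g} \<union> {g \<in> \<Omega>. A i g \<and> (\<forall>j\<in>S. \<not> A j g)} =
      {g \<in> \<Omega>. \<forall>j\<in>S. \<not> A j g}" by auto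
    ultimately show ?thesis by (simp add: N_def L_def)
  qed
  have key: "L i S \<le> x * N S" if "S \<subseteq> I" "i \<in> I" "i \<notin> S" for i S
    using that
  proof (induction "card S" arbitrary: S i rule: less_induct)
    case less
    have finS: "finite S" using less.prems(1) fin(4) finite_subset by blast
    define S1 where "S1 = {j \<in> S. vars j \<inter> vars i \<noteq> {}}"
    define S2 where "S2 = S - S1"
    have S: "S = S2 \<union> S1" "S2 \<inter> S1 = {}" by (auto simp: S1_def S2_def)
    have finS1: "finite S1" using finS S(1) by simp
    have "card {g \<in> \<Omega>. A i g \<and> (\<forall>j\<in>S2. \<not> A j g)} * card \<Omega> =
        card {g \<in> \<Omega>. A i g} * card {g \<in> \<Omega>. \<forall>j\<in>S2. \<not> A j g}"
    proof (rule card_independent[where J = "vars i" and C = C and Q = Q])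
      show "vars i \<subseteq> C" by (rule vars) fact
      show "\<Omega> = PiE C (\<lambda>_. Q)" by (rule \<Omega>_def)
      show "A i g'" if "\<And>v. v \<in> vars i \<Longrightarrow> g v = g' v" "A i g" for g g'
        using dep[OF \<open>i \<in> I\<close> that] .
      fix g g' assume eq: "\<And>v. v \<in> C - vars i \<Longrightarrow> g v = g' v" and none: "\<forall>j\<in>S2. \<not> A j g"
      show "\<forall>j\<in>S2. \<not> A j g'"
      proof
        fix j assume j: "j \<in> S2"
        then have "j \<in> I" "vars j \<subseteq> C - vars i"
          using less.prems(1) vars[of j] by (auto simp: S1_def S2_def)
        then show "\<not> A j g'" using dep[of j g' g] eq none j by (metis subsetD)
      qed
    qed
    then have "L i S2 * real (card \<Omega>) = real (card {g \<in> \<Omega>. A i g}) * N S2"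
      unfolding L_def N_def of_nat_mult[symmetric] of_nat_eq_iff .
    also have "\<dots> \<le> (x * (1 - x) ^ d * card \<Omega>) * N S2"
      using prob[OF less.prems(2)] unfolding \<Omega>_def by (intro mult_right_mono) (auto simp: N_def)
    finally have "L i S2 \<le> x * (1 - x) ^ d * N S2" using pos\<Omega> by simp
    moreover have "L i S \<le> L i S2"
      unfolding L_def of_nat_le_iff using fin\<Omega> S(1) by (intro card_mono) auto
    moreover have "(1 - x) ^ d * N S2 \<le> N S"
    proof -
      have "(1 - x) ^ card R * N S2 \<le> N (S2 \<union> R)" if "R \<subseteq> S1" for R
        using finite_subset[OF that finS1] that
      proof (induction R)
        case (insert j R)
        have sub: "S2 \<union> R \<subset> S" "j \<notin> S2 \<union> R" using insert S by auto
        then have "card (S2 \<union> R) < card S" using finS by (intro psubset_card_mono)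
        moreover have "j \<in> I" "S2 \<union> R \<subseteq> I" using insert.prems less.prems(1) S(1) sub by auto
        ultimately have "L j (S2 \<union> R) \<le> x * N (S2 \<union> R)" using less.hyps sub by blast
        then have "N (S2 \<union> insert j R) \<ge> (1 - x) * N (S2 \<union> R)"
          using N_insert[of "S2 \<union> R" j] by (simp add: algebra_simps)
        moreover have "(1 - x) * N (S2 \<union> R) \<ge> (1 - x) * ((1 - x) ^ card R * N S2)"
          using insert x by (intro mult_left_mono) auto
        ultimately show ?case using insert by simp
      qed simp
      then have "(1 - x) ^ card S1 * N S2 \<le> N S" using S(1) by auto
      moreover have "card S1 \<le> d"
      proof -
        have "S1 \<subseteq> {j \<in> I. j \<noteq> i \<and> vars j \<inter> vars i \<noteq> {}}" using less.prems by (auto simp: S1_def)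
        then have "card S1 \<le> card {j \<in> I. j \<noteq> i \<and> vars j \<inter> vars i \<noteq> {}}"
          using fin(4) by (intro card_mono) auto
        then show ?thesis using deg[OF less.prems(2)] by linarith
      qed
      then have "(1 - x) ^ d * N S2 \<le> (1 - x) ^ card S1 * N S2"
        using x by (intro mult_right_mono power_decreasing) (auto simp: N_def)
      ultimately show ?thesis by linarith
    qed
    then have "x * ((1 - x) ^ d * N S2) \<le> x * N S" using x(1) by (rule mult_left_mono)
    ultimately show ?case by (simp add: mult.assoc)
  qed
  have "N S > 0" if "S \<subseteq> I" for S
    using finite_subset[OF that fin(4)] that
  proof (induction S)
    case empty
    then show ?case using pos\<Omega> by (simp add: N_def)
  next
    case (insert i S)
    then have "L i S \<le> x * N S" by (intro key) auto
    then have "N (insert i S) \<ge> (1 - x) * N S" using N_insert[of S i] by (simp add: algebra_simps)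
    moreover have "(1 - x) * N S > 0" using insert x by simp
    ultimately show ?case by linarith
  qed
  from this[of I] have "card {g \<in> \<Omega>. \<forall>j\<in>I. \<not> A j g} \<noteq> 0" by (simp add: N_def)
  then have "{g \<in> \<Omega>. \<forall>j\<in>I. \<not> A j g} \<noteq> {}" by (intro notI) (simp only: card.empty)
  then show ?thesis unfolding \<Omega>_def by blast
qed

text \<open>
  For \<open>d > 0\<close> the weight is \<open>x = 1 / (d + 1)\<close>, by \<open>(1 + 1 / d)\<^sup>d \<le> e\<close>. For \<open>d = 0\<close> that weight would be
  \<open>1\<close>, which the local lemma excludes, but \<open>x = 1 / e\<close> suffices.
\<close>

lemma local_lemma_weight:
  "\<exists>x. 0 \<le> x \<and> x < 1 \<and> 1 / (exp 1 * (real d + 1)) \<le> x * (1 - x) ^ d"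
proof (cases d)
  case 0
  have "exp (1 :: real) > 1" by simp
  then show ?thesis using 0 by (intro exI[of _ "1 / exp 1"]) (simp add: field_simps)
next
  case (Suc m)
  define y :: real where "y = 1 / real d"
  have "(1 + y) ^ d \<le> exp y ^ d" using Suc by (intro power_mono exp_ge_add_one_self) (auto simp: y_def)
  also have "\<dots> = exp (real d * y)" by (rule exp_of_nat_mult[symmetric])
  also have "real d * y = 1" using Suc by (simp add: y_def)
  finally have le: "(1 + y) ^ d \<le> exp 1" .
  have "1 - 1 / (real d + 1) = 1 / (1 + y)" using Suc by (simp add: y_def field_simps)
  then have "(1 - 1 / (real d + 1)) ^ d = 1 / (1 + y) ^ d" by (simp add: power_one_over)
  also have "\<dots> \<ge> 1 / exp 1" using le Suc by (intro divide_left_mono) (auto simp: y_def intro!: mult_pos_pos zero_less_power add_pos_nonneg)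
  finally have "1 / exp 1 \<le> (1 - 1 / (real d + 1)) ^ d" .
  then have "1 / (real d + 1) * (1 / exp 1) \<le> 1 / (real d + 1) * (1 - 1 / (real d + 1)) ^ d"
    by (intro mult_left_mono) auto
  then show ?thesis using Suc by (intro exI[of _ "1 / (real d + 1)"]) (auto simp: field_simps)
qed


section \<open>Conditional violation probabilities\<close>

text \<open>
  The probability that a random colour of \<open>x\<close> equals \<open>v\<close> when \<open>f\<close> has been revealed on \<open>V\<close> and the other
  colours are uniform and independent. Accordingly, \<open>cond_prob q V f B\<close> is the conditional
  probability that \<open>B\<close> is violated.
\<close>

definition reveal_weight :: "nat \<Rightarrow> 'a set \<Rightarrow> ('a \<Rightarrow> nat) \<Rightarrow> 'a \<Rightarrow> nat option \<Rightarrow> real" where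
  "reveal_weight q V f x v = (if x \<in> V then of_bool (v = Some (f x)) else 1 / real q)"

definition cond_prob :: "nat \<Rightarrow> 'a set \<Rightarrow> ('a \<Rightarrow> nat) \<Rightarrow> ('a \<rightharpoonup> nat) set \<Rightarrow> real" where
  "cond_prob q V f B = (\<Sum>g\<in>B. \<Prod>x\<in>constraint_dom B. reveal_weight q V f x (g x))"

lemma is_constraintD:
  assumes "is_constraint X q B"
  shows "finite (constraint_dom B)" "constraint_dom B \<subseteq> X" "finite B"
    "\<And>g. g \<in> B \<Longrightarrow> dom g = constraint_dom B" "\<And>g. g \<in> B \<Longrightarrow> ran g \<subseteq> {..<q}"
proof -
  obtain D where D: "finite D" "D \<subseteq> X" "B \<subseteq> {g. dom g = D \<and> ran g \<subseteq> {..<q}}"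
    using assms unfolding is_constraint_def by blast
  have "finite {g :: 'a \<rightharpoonup> nat. dom g = D \<and> ran g \<subseteq> {..<q}}"
    using D(1) by (intro finite_set_of_finite_maps) auto
  then show "finite B" using D(3) by (rule finite_subset[rotated])
  have eq: "constraint_dom B = D" if "B \<noteq> {}" using constraint_dom_eq[OF D(3) that] .
  show "finite (constraint_dom B)" "constraint_dom B \<subseteq> X"
    using eq D(1,2) by (cases "B = {}"; simp add: constraint_dom_def)+
  show "dom g = constraint_dom B" "ran g \<subseteq> {..<q}" if "g \<in> B" for g
    using eq D(3) that by blast+
qed

lemma cond_prob_nonneg: "cond_prob q V f B \<ge> 0"
  unfolding cond_prob_def by (intro sum_nonneg prod_nonneg) (auto simp: reveal_weight_def)

lemma cond_prob_cong:
  assumes "\<And>x. x \<in> constraint_dom B \<Longrightarrow> x \<in> V \<longleftrightarrow> x \<in> V'"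
    and "\<And>x. x \<in> constraint_dom B \<Longrightarrow> x \<in> V' \<Longrightarrow> f x = f' x"
  shows "cond_prob q V f B = cond_prob q V' f' B"
  unfolding cond_prob_def using assms
  by (intro sum.cong prod.cong refl) (simp add: reveal_weight_def)

lemma cond_prob_empty: "cond_prob q {} f B = constraint_prob q B"
  by (simp add: cond_prob_def constraint_prob_def reveal_weight_def power_one_over divide_inverse
      power_inverse)

lemma cond_prob_violated:
  assumes "is_constraint X q B" "violates f B" "constraint_dom B \<subseteq> V"
  shows "cond_prob q V f B \<ge> 1"
proof -
  let ?g = "(Some \<circ> f) |` constraint_dom B"
  have "(\<Prod>x\<in>constraint_dom B. reveal_weight q V f x (?g x)) = 1"
    using assms(3) by (intro prod.neutral) (auto simp: reveal_weight_def)
  moreover have "(\<Prod>x\<in>constraint_dom B. reveal_weight q V f x (?g x)) \<le> cond_prob q V f B"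
    unfolding cond_prob_def using assms(2) is_constraintD(3)[OF assms(1)]
    by (intro member_le_sum[where f = "\<lambda>g. \<Prod>x\<in>constraint_dom B. reveal_weight q V f x (g x)"])
      (auto simp: violates_def reveal_weight_def intro!: prod_nonneg)
  ultimately show ?thesis by simp
qed

text \<open>
  The martingale property: the average over all colourings of \<open>C\<close> of the conditional probability after
  revealing \<open>C\<close> as well is the conditional probability before. For a single member \<open>g\<close> of \<open>B\<close>, the
  average of the product of weights factorizes over \<open>C\<close>.
\<close>

lemma cond_prob_average:
  assumes B: "is_constraint X q B" and "q > 0" "finite C" "C \<inter> V = {}"
  defines "\<Omega> \<equiv> PiE C (\<lambda>_. {..<q})"
  shows "(\<Sum>h\<in>\<Omega>. cond_prob q (V \<union> C) (override_on f h C) B) = card \<Omega> * cond_prob q V f B"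
proof -
  let ?D = "constraint_dom B"
  have "(\<Sum>h\<in>\<Omega>. \<Prod>x\<in>?D. reveal_weight q (V \<union> C) (override_on f h C) x (g x)) =
    card \<Omega> * (\<Prod>x\<in>?D. reveal_weight q V f x (g x))" if g: "g \<in> B" for g
  proof -
    \<comment> \<open>the part of the product that does not depend on the colours in \<open>C\<close>\<close>
    define P where "P = (\<Prod>x\<in>?D - C. reveal_weight q V f x (g x))"
    have fin: "finite ?D" by (rule is_constraintD(1)[OF B])
    have split: "(\<Prod>x\<in>?D. w x) = (\<Prod>x\<in>?D - C. w x) * (\<Prod>x\<in>?D \<inter> C. w x)" for w :: "'a \<Rightarrow> real"
    proof -
      have "(\<Prod>x\<in>(?D - C) \<union> (?D \<inter> C). w x) = (\<Prod>x\<in>?D - C. w x) * (\<Prod>x\<in>?D \<inter> C. w x)"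
        using fin by (intro prod.union_disjoint) auto
      moreover have "(?D - C) \<union> (?D \<inter> C) = ?D" by blast
      ultimately show ?thesis by simp
    qed
    let ?u = "\<lambda>x v. if x \<in> ?D then of_bool (g x = Some v) else (1 :: real)"
    have restrict: "(\<Prod>x\<in>?D \<inter> C. w x) = (\<Prod>x\<in>C. if x \<in> ?D then w x else 1)" for w :: "'a \<Rightarrow> real"
      using prod.inter_restrict[OF assms(3), of w ?D] by (simp add: Int_commute)
    have "(\<Prod>x\<in>?D. reveal_weight q (V \<union> C) (override_on f h C) x (g x)) = P * (\<Prod>x\<in>C. ?u x (h x))"
      for h
    proof -
      have "(\<Prod>x\<in>?D - C. reveal_weight q (V \<union> C) (override_on f h C) x (g x)) = P"
        unfolding P_def by (intro prod.cong refl) (auto simp: reveal_weight_def)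
      moreover have "(\<Prod>x\<in>?D \<inter> C. reveal_weight q (V \<union> C) (override_on f h C) x (g x)) =
          (\<Prod>x\<in>C. ?u x (h x))"
        unfolding restrict by (intro prod.cong refl) (auto simp: reveal_weight_def)
      ultimately show ?thesis unfolding split by simp
    qed
    then have "(\<Sum>h\<in>\<Omega>. \<Prod>x\<in>?D. reveal_weight q (V \<union> C) (override_on f h C) x (g x)) =
      P * (\<Sum>h\<in>\<Omega>. \<Prod>x\<in>C. ?u x (h x))"
      by (simp add: sum_distrib_left)
    also have "(\<Sum>h\<in>\<Omega>. \<Prod>x\<in>C. ?u x (h x)) = (\<Prod>x\<in>C. \<Sum>v<q. ?u x v)"
      unfolding \<Omega>_def using assms(3) by (intro prod_sum_PiE[symmetric]) auto
    also have "\<dots> = (\<Prod>x\<in>C. real q * (if x \<in> ?D then 1 / real q else 1))"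
    proof (intro prod.cong refl)
      fix x
      show "(\<Sum>v<q. ?u x v) = real q * (if x \<in> ?D then 1 / real q else 1)"
      proof (cases "x \<in> ?D")
        case True
        then obtain c where c: "g x = Some c" using is_constraintD(4)[OF B g] by blast
        then have "c < q" using is_constraintD(5)[OF B g] by (meson lessThan_iff ranI subsetD)
        then have "(\<Sum>v<q. of_bool (c = v)) = (1 :: real)"
          by (simp add: of_bool_def sum.delta)
        then show ?thesis using True c \<open>q > 0\<close> by simp
      qed simp
    qed
    also have "\<dots> = real q ^ card C * (\<Prod>x\<in>?D \<inter> C. 1 / real q)"
      unfolding restrict by (simp add: prod.distrib)
    also have "real q ^ card C = card \<Omega>" unfolding \<Omega>_def using assms(3) by (simp add: card_PiE)
    also have "(\<Prod>x\<in>?D \<inter> C. 1 / real q) = (\<Prod>x\<in>?D \<inter> C. reveal_weight q V f x (g x))"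
      using assms(4) by (intro prod.cong refl) (auto simp: reveal_weight_def)
    finally show ?thesis unfolding split P_def by (simp add: mult_ac)
  qed
  then have "(\<Sum>g\<in>B. \<Sum>h\<in>\<Omega>. \<Prod>x\<in>?D. reveal_weight q (V \<union> C) (override_on f h C) x (g x)) =
    card \<Omega> * cond_prob q V f B"
    by (simp add: cond_prob_def sum_distrib_left)
  then show ?thesis unfolding cond_prob_def by (subst sum.swap)
qed

lemma cond_prob_markov:
  assumes "is_constraint X q B" and "q > 0" "finite C" "C \<inter> V = {}"
    and "cond_prob q V f B > 0" "\<theta> > 0"
  defines "\<Omega> \<equiv> PiE C (\<lambda>_. {..<q})"
  shows "card {h \<in> \<Omega>. \<theta> * cond_prob q V f B \<le> cond_prob q (V \<union> C) (override_on f h C) B}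
    \<le> 1 / \<theta> * card \<Omega>"
proof -
  let ?c = "\<lambda>h. cond_prob q (V \<union> C) (override_on f h C) B"
  let ?S = "{h \<in> \<Omega>. \<theta> * cond_prob q V f B \<le> ?c h}"
  have fin: "finite \<Omega>" unfolding \<Omega>_def using assms(3) by (intro finite_PiE) auto
  have "card ?S * (\<theta> * cond_prob q V f B) = (\<Sum>h\<in>?S. \<theta> * cond_prob q V f B)" by simp
  also have "\<dots> \<le> (\<Sum>h\<in>?S. ?c h)" by (intro sum_mono) auto
  also have "\<dots> \<le> (\<Sum>h\<in>\<Omega>. ?c h)" using fin by (intro sum_mono2) (auto simp: cond_prob_nonneg)
  also have "\<dots> = card \<Omega> * cond_prob q V f B"
    unfolding \<Omega>_def by (rule cond_prob_average) fact+
  finally have "(card ?S * \<theta>) * cond_prob q V f B \<le> card \<Omega> * cond_prob q V f B" by (simp add: mult_ac)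
  then have "card ?S * \<theta> \<le> card \<Omega>" using assms(5) by simp
  then show ?thesis using assms(6) by (simp add: field_simps)
qed

section \<open>Colouring a finite component\<close>

text \<open>
  The bad event of a stage, in which \<open>U\<close> is coloured. Constraints that are already impossible to violate
  are exempt, as for them the second condition would always hold.
\<close>

definition overshoots ::
  "nat \<Rightarrow> real \<Rightarrow> 'a set \<Rightarrow> 'a set \<Rightarrow> ('a \<Rightarrow> nat) \<Rightarrow> ('a \<Rightarrow> nat) \<Rightarrow> ('a \<rightharpoonup> nat) set \<Rightarrow> bool" where
  "overshoots q \<theta> V U f f' B \<longleftrightarrow>
     0 < cond_prob q V f B \<and> \<theta> * cond_prob q V f B \<le> cond_prob q (V \<union> U) f' B"

lemma finite_constraints_at:
  assumes "\<And>B. B \<in> \<B> \<Longrightarrow> finite (csp_neighbours \<B> B) \<and> card (csp_neighbours \<B> B) \<le> d"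
  shows "finite {B \<in> \<B>. x \<in> constraint_dom B} \<and> card {B \<in> \<B>. x \<in> constraint_dom B} \<le> d + 1"
proof (cases "\<exists>B\<in>\<B>. x \<in> constraint_dom B")
  case True
  then obtain B where B: "B \<in> \<B>" "x \<in> constraint_dom B" by blast
  then have sub: "{B \<in> \<B>. x \<in> constraint_dom B} \<subseteq> insert B (csp_neighbours \<B> B)"
    by (auto simp: csp_neighbours_def)
  have fin: "finite (insert B (csp_neighbours \<B> B))" using assms[OF B(1)] by simp
  have "card (insert B (csp_neighbours \<B> B)) \<le> d + 1"
    using assms[OF B(1)] card_insert_le_m1[of "d + 1"] by (simp add: card_insert_if)
  then show ?thesis using card_mono[OF fin sub] finite_subset[OF sub fin] by simp
next
  case False
  then have "{B \<in> \<B>. x \<in> constraint_dom B} = {}" by blast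
  then show ?thesis by (simp only: card.empty finite.emptyI) simp
qed

lemma constraint_dom_in_component:
  assumes "B \<in> \<B>" "constraint_dom B \<subseteq> X" "y \<in> constraint_dom B" "y \<in> U" "z \<in> constraint_dom B" "z \<in> U"
  shows "(y, z) \<in> (csp_graph X \<B> \<inter> U \<times> U)\<^sup>*"
proof (cases "y = z")
  case False
  then have "(y, z) \<in> csp_graph X \<B> \<inter> U \<times> U" using assms by (auto simp: csp_graph_def)
  then show ?thesis by blast
qed simp

text \<open>
  The domain of a constraint meets \<open>U\<close> in a clique, so all points of \<open>U\<close> in it are in the same
  component. Hence for a constraint meeting \<open>C\<close> it makes no difference whether the colours in \<open>C\<close> or in
  \<open>U\<close> are revealed, and the bad events of these constraints are events over the finite set \<open>C\<close>. Events
  that share a point of \<open>C\<close> come from constraints that are neighbours.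
\<close>

lemma component_colouring:
  fixes \<B> :: "('a \<rightharpoonup> nat) set set"
  assumes csp: "is_csp X q \<B>" and "q > 0"
    and d: "\<And>B. B \<in> \<B> \<Longrightarrow> finite (csp_neighbours \<B> B) \<and> card (csp_neighbours \<B> B) \<le> d"
    and "U \<inter> V = {}" "U \<subseteq> X" "x \<in> U"
  defines "C \<equiv> (csp_graph X \<B> \<inter> U \<times> U)\<^sup>* `` {x}"
  assumes finC: "finite C"
  shows "C \<subseteq> U \<and> (\<exists>h \<in> PiE C (\<lambda>_. {..<q}). \<forall>B\<in>\<B>. constraint_dom B \<inter> C \<noteq> {} \<longrightarrow>
    \<not> overshoots q (exp 1 * (real d + 1)) V U f (override_on f h C) B)"
proof -
  let ?E = "csp_graph X \<B> \<inter> U \<times> U"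
  have C_sub: "C \<subseteq> U"
  proof
    fix y assume "y \<in> C"
    then have "(x, y) \<in> ?E\<^sup>*" by (simp add: C_def)
    then show "y \<in> U" using \<open>x \<in> U\<close> by (induction rule: rtrancl_induct) auto
  qed
  have con: "is_constraint X q B" if "B \<in> \<B>" for B using csp that by (simp add: is_csp_def)
  have dom_C: "constraint_dom B \<inter> U \<subseteq> C"
    if B: "B \<in> \<B>" and meets: "constraint_dom B \<inter> C \<noteq> {}" for B
  proof
    fix z assume z: "z \<in> constraint_dom B \<inter> U"
    obtain y where y: "y \<in> constraint_dom B" "y \<in> C" using meets by blast
    have "(y, z) \<in> ?E\<^sup>*"
      using y z C_sub is_constraintD(2)[OF con[OF B]]
      by (intro constraint_dom_in_component[OF B]) auto
    moreover have "(x, y) \<in> ?E\<^sup>*" using y(2) by (simp add: C_def)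
    ultimately show "z \<in> C" unfolding C_def by (simp add: rtrancl_trans)
  qed
  define I where "I = {B \<in> \<B>. constraint_dom B \<inter> C \<noteq> {}}"
  have "I = (\<Union>y\<in>C. {B \<in> \<B>. y \<in> constraint_dom B})" by (auto simp: I_def)
  moreover have "finite {B \<in> \<B>. y \<in> constraint_dom B}" for y
    using finite_constraints_at[of \<B> d y, OF d] by blast
  ultimately have finI: "finite I" using finC by simp
  define \<theta> where "\<theta> = exp 1 * (real d + 1)"
  have \<theta>: "\<theta> > 0" by (simp add: \<theta>_def)
  let ?\<Omega> = "PiE C (\<lambda>_. {..<q})"
  have CV: "C \<inter> V = {}" using C_sub assms(4) by blast
  obtain p where p: "0 \<le> p" "p < 1" "1 / \<theta> \<le> p * (1 - p) ^ d"
    using local_lemma_weight[of d] unfolding \<theta>_def by blast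
  have "\<exists>h\<in>?\<Omega>. \<forall>B\<in>I. \<not> overshoots q \<theta> V C f (override_on f h C) B"
  proof (rule finite_local_lemma[where vars = "\<lambda>B. constraint_dom B \<inter> C"])
    show "finite C" "finite {..<q}" "{..<q} \<noteq> {}" "finite I" "0 \<le> p" "p < 1"
      using finC finI p \<open>q > 0\<close> by auto
    fix B assume B: "B \<in> I"
    then have B': "B \<in> \<B>" by (simp add: I_def)
    show "constraint_dom B \<inter> C \<subseteq> C" by blast
    have sub: "{j \<in> I. j \<noteq> B \<and> constraint_dom j \<inter> C \<inter> (constraint_dom B \<inter> C) \<noteq> {}} \<subseteq> csp_neighbours \<B> B"
      by (auto simp: I_def csp_neighbours_def)
    show "card {j \<in> I. j \<noteq> B \<and> constraint_dom j \<inter> C \<inter> (constraint_dom B \<inter> C) \<noteq> {}} \<le> d"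
      using card_mono[OF _ sub] d[OF B'] by linarith
    show "overshoots q \<theta> V C f (override_on f g' C) B"
      if "\<And>v. v \<in> constraint_dom B \<inter> C \<Longrightarrow> g v = g' v" "overshoots q \<theta> V C f (override_on f g C) B"
      for g g'
    proof -
      have "cond_prob q (V \<union> C) (override_on f g C) B = cond_prob q (V \<union> C) (override_on f g' C) B"
        using that(1) by (intro cond_prob_cong) (auto simp: override_on_def)
      then show ?thesis using that(2) by (simp add: overshoots_def)
    qed
    show "real (card {g \<in> ?\<Omega>. overshoots q \<theta> V C f (override_on f g C) B})
        \<le> p * (1 - p) ^ d * real (card ?\<Omega>)"
    proof (cases "cond_prob q V f B > 0")
      case True
      then have "real (card {g \<in> ?\<Omega>. overshoots q \<theta> V C f (override_on f g C) B}) \<le> 1 / \<theta> * card ?\<Omega>"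
        using cond_prob_markov[OF con[OF B'] \<open>q > 0\<close> finC CV True \<theta>] by (simp add: overshoots_def)
      also have "\<dots> \<le> p * (1 - p) ^ d * real (card ?\<Omega>)" using p(3) by (intro mult_right_mono) auto
      finally show ?thesis .
    next
      case False
      then show ?thesis using p by (simp add: overshoots_def)
    qed
  qed
  then obtain h where h: "h \<in> ?\<Omega>" "\<And>B. B \<in> I \<Longrightarrow> \<not> overshoots q \<theta> V C f (override_on f h C) B" by blast
  have "\<not> overshoots q \<theta> V U f (override_on f h C) B" if "B \<in> \<B>" "constraint_dom B \<inter> C \<noteq> {}" for B
  proof -
    have "cond_prob q (V \<union> U) (override_on f h C) B = cond_prob q (V \<union> C) (override_on f h C) B"
      using dom_C[OF that] C_sub by (intro cond_prob_cong) auto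
    then show ?thesis using h(2)[of B] that by (simp add: I_def overshoots_def)
  qed
  then show ?thesis using C_sub h(1) unfolding \<theta>_def by blast
qed


section \<open>Borel sets of points defined by constraints\<close>

lemma measurable_image_finite_subsets:
  "(\<lambda>x. x ` {..<k}) \<in> measurable (distinct_tuples N k) (finite_subsets N)"
proof (rule measurableI)
  show "x ` {..<k} \<in> space (finite_subsets N)" if "x \<in> space (distinct_tuples N k)" for x
    using that
    by (auto simp: distinct_tuples_def space_restrict_space space_PiM space_finite_subsets Fpow_def)
  fix A assume "A \<in> sets (finite_subsets N)"
  then have "{x \<in> space (distinct_tuples N k). x ` {..<k} \<in> A} \<in> sets (distinct_tuples N k)"
    unfolding sets_finite_subsets by blast
  moreover have "(\<lambda>x. x ` {..<k}) -` A \<inter> space (distinct_tuples N k) =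
    {x \<in> space (distinct_tuples N k). x ` {..<k} \<in> A}" by blast
  ultimately show "(\<lambda>x. x ` {..<k}) -` A \<inter> space (distinct_tuples N k) \<in> sets (distinct_tuples N k)"
    by simp
qed

lemma measurable_distinct_tuples:
  assumes "\<And>j. j < k \<Longrightarrow> F j \<in> measurable N N'"
    and "\<And>x. x \<in> space N \<Longrightarrow> inj_on (\<lambda>j. F j x) {..<k}"
  shows "(\<lambda>x. \<lambda>j\<in>{..<k}. F j x) \<in> measurable N (distinct_tuples N' k)"
  unfolding distinct_tuples_def
proof (rule measurable_restrict_space2)
  show "(\<lambda>x. \<lambda>j\<in>{..<k}. F j x) \<in> measurable N (PiM {..<k} (\<lambda>_. N'))"
    using assms(1) by (intro measurable_restrict) auto
  show "(\<lambda>x. \<lambda>j\<in>{..<k}. F j x) \<in> space N \<rightarrow> {x. inj_on x {..<k}}"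
    using assms(2) by (auto simp: inj_on_def)
qed

text \<open>
  A constraint on \<open>n\<close> points is given by an abstract constraint \<open>B0\<close>, a set of functions
  \<open>{..<n} \<rightarrow> {..<q}\<close>, and an injective tuple \<open>t\<close> that places it: it is the image of \<open>B0\<close> under
  \<open>inst n t\<close>. As there are only countably many abstract constraints, Borel questions about constraints
  become Borel questions about tuples.
\<close>

definition inst :: "nat \<Rightarrow> (nat \<Rightarrow> 'a) \<Rightarrow> (nat \<Rightarrow> nat) \<Rightarrow> ('a \<rightharpoonup> nat)" where
  "inst n t g = (\<lambda>x. if x \<in> t ` {..<n} then Some (g (the_inv_into {..<n} t x)) else None)"

lemma dom_inst: "dom (inst n t g) = t ` {..<n}"
  by (auto simp: inst_def dom_def)

lemma inst_apply: "inj_on t {..<n} \<Longrightarrow> j < n \<Longrightarrow> inst n t g (t j) = Some (g j)"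
  by (simp add: inst_def the_inv_into_f_f)

lemma inst_eq_Some_iff:
  "inj_on t {..<n} \<Longrightarrow> inst n t g x = Some c \<longleftrightarrow> (\<exists>j<n. x = t j \<and> c = g j)"
  by (cases "x \<in> t ` {..<n}") (auto simp: inst_apply, auto simp: inst_def)

lemma ran_inst: "inj_on t {..<n} \<Longrightarrow> ran (inst n t g) = g ` {..<n}"
  by (auto simp: ran_def inst_eq_Some_iff)

lemma graph_inst: "inj_on t {..<n} \<Longrightarrow> Map.graph (inst n t g) = (\<lambda>j. (t j, g j)) ` {..<n}"
  by (auto simp: Map.graph_def inst_eq_Some_iff)

lemma inst_eqD:
  assumes "inj_on t {..<n}" "inst n t g = inst n t g'" "g \<in> extensional {..<n}" "g' \<in> extensional {..<n}"
  shows "g = g'"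
proof (rule extensionalityI[OF assms(3,4)])
  fix j assume "j \<in> {..<n}"
  then show "g j = g' j"
    using inst_apply[OF assms(1), of j g] inst_apply[OF assms(1), of j g'] assms(2) by simp
qed

lemma inst_const_dom: "constraint_dom (inst n t ` B0) = (if B0 = {} then {} else t ` {..<n})"
  by (auto simp: constraint_dom_def dom_inst)

lemma is_constraint_inst:
  assumes "inj_on t {..<n}" "t ` {..<n} \<subseteq> X" "B0 \<subseteq> PiE {..<n} (\<lambda>_. {..<q})"
  shows "is_constraint X q (inst n t ` B0)"
  unfolding is_constraint_def
proof (intro exI[of _ "t ` {..<n}"] conjI)
  show "inst n t ` B0 \<subseteq> {g. dom g = t ` {..<n} \<and> ran g \<subseteq> {..<q}}"
  proof
    fix g assume "g \<in> inst n t ` B0"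
    then obtain b where "b \<in> B0" "g = inst n t b" by blast
    moreover then have "b ` {..<n} \<subseteq> {..<q}" using assms(3) by (auto simp: PiE_iff)
    ultimately show "g \<in> {g. dom g = t ` {..<n} \<and> ran g \<subseteq> {..<q}}"
      by (simp add: dom_inst ran_inst[OF assms(1)])
  qed
qed (use assms(2) in auto)

lemma constraint_is_inst:
  assumes "is_constraint X q B"
  obtains n t B0 where "t \<in> PiE {..<n} (\<lambda>_. X)" "inj_on t {..<n}" "t ` {..<n} = constraint_dom B"
    "B0 \<subseteq> PiE {..<n} (\<lambda>_. {..<q})" "B = inst n t ` B0"
proof -
  let ?D = "constraint_dom B" and ?n = "card (constraint_dom B)"
  note D = is_constraintD[OF assms]
  obtain t0 where t0: "bij_betw t0 {..<?n} ?D"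
    using ex_bij_betw_nat_finite[OF D(1)] by (auto simp: atLeast0LessThan)
  define t where "t = restrict t0 {..<?n}"
  have t: "inj_on t {..<?n}" "t ` {..<?n} = ?D"
    using t0 by (auto simp: t_def bij_betw_def inj_on_def)
  define r where "r b = (\<lambda>j\<in>{..<?n}. the (b (t j)))" for b :: "'a \<rightharpoonup> nat"
  have inst_r: "inst ?n t (r b) = b" if "b \<in> B" for b
  proof
    fix x
    show "inst ?n t (r b) x = b x"
    proof (cases "x \<in> ?D")
      case True
      then obtain j where j: "j < ?n" "x = t j" using t(2) by auto
      moreover have "b x \<noteq> None" using D(4)[OF that] True by blast
      ultimately show ?thesis using inst_apply[OF t(1) j(1), of "r b"] by (auto simp: r_def)
    next
      case False
      then have "inst ?n t (r b) x = None" using t(2) by (simp add: inst_def)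
      moreover have "b x = None" using D(4)[OF that] False by blast
      ultimately show ?thesis by simp
    qed
  qed
  have "r b \<in> PiE {..<?n} (\<lambda>_. {..<q})" if "b \<in> B" for b
  proof (rule PiE_I)
    fix j assume j: "j \<in> {..<?n}"
    then have "t j \<in> dom b" using D(4)[OF that] t(2) by blast
    then show "r b j \<in> {..<q}" using D(5)[OF that] j by (auto simp: r_def intro: ranI)
  qed (simp add: r_def)
  then have "r ` B \<subseteq> PiE {..<?n} (\<lambda>_. {..<q})" by blast
  moreover have "B = inst ?n t ` (r ` B)"
  proof -
    have "inst ?n t ` (r ` B) = (\<lambda>b. b) ` B"
      unfolding image_image by (rule image_cong) (simp_all add: inst_r)
    then show ?thesis by simp
  qed
  moreover have "t \<in> PiE {..<?n} (\<lambda>_. X)" using t(2) D(2) by (auto simp: t_def)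
  ultimately show thesis using t that[of t ?n "r ` B"] by blast
qed

lemma measurable_inst:
  assumes "g \<in> PiE {..<n} (\<lambda>_. {..<q})"
  shows "(\<lambda>t. inst n t g) \<in> measurable (distinct_tuples M n) (partial_function_space M q)"
  unfolding partial_function_space_def
proof (rule measurable_vimage_algebra2)
  let ?DT = "distinct_tuples M n"
  have spc: "inj_on t {..<n}" "t ` {..<n} \<subseteq> space M" if "t \<in> space ?DT" for t
    using that by (auto simp: distinct_tuples_def space_restrict_space space_PiM)
  have ran: "g ` {..<n} \<subseteq> {..<q}" using assms by (auto simp: PiE_iff)
  show "(\<lambda>t. inst n t g) \<in> space ?DT \<rightarrow> finite_partial_functions (space M) q"
    using spc ran by (auto simp: finite_partial_functions_def dom_inst ran_inst)
  have "(\<lambda>t. \<lambda>j\<in>{..<n}. (t j, g j)) \<in>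
      measurable ?DT (distinct_tuples (M \<Otimes>\<^sub>M count_space {..<q}) n)"
  proof (rule measurable_distinct_tuples)
    fix j assume j: "j < n"
    have "(\<lambda>t. t j) \<in> measurable ?DT M"
      unfolding distinct_tuples_def using j
      by (intro measurable_restrict_space1 measurable_component_singleton) auto
    then show "(\<lambda>t. (t j, g j)) \<in> measurable ?DT (M \<Otimes>\<^sub>M count_space {..<q})"
      using ran j by (intro measurable_Pair measurable_const) auto
  qed (use spc in \<open>auto simp: inj_on_def\<close>)
  from measurable_compose[OF this measurable_image_finite_subsets]
  have "(\<lambda>t. (\<lambda>j. (t j, g j)) ` {..<n}) \<in> measurable ?DT (finite_subsets (M \<Otimes>\<^sub>M count_space {..<q}))"
    by simp
  then show "(\<lambda>t. Map.graph (inst n t g)) \<in> measurable ?DT (finite_subsets (M \<Otimes>\<^sub>M count_space {..<q}))"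
    using spc by (subst measurable_cong[of _ _ "\<lambda>t. (\<lambda>j. (t j, g j)) ` {..<n}"]) (auto simp: graph_inst)
qed

text \<open>
  The diagonal of \<open>M \<times> M\<close> is Borel because points are equal iff their codes in the Baire space are.
\<close>

lemma sets_inj_tuples:
  assumes "standard_borel M"
  shows "{t \<in> space (PiM {..<n :: nat} (\<lambda>_. M)). inj_on t {..<n}} \<in> sets (PiM {..<n} (\<lambda>_. M))"
proof (cases "space M = {}")
  case True
  show ?thesis
  proof (cases "n = 0")
    case False
    then have "space (PiM {..<n} (\<lambda>_. M)) = {}" using True by (auto simp: space_PiM PiE_eq_empty_iff)
    then have "{t \<in> space (PiM {..<n} (\<lambda>_. M)). inj_on t {..<n}} = {}" by blast
    then show ?thesis by (simp only: sets.empty_sets)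
  qed simp
next
  case False
  then obtain \<sigma> h where r: "baire_retraction M \<sigma> h"
    using standard_borel_baire_retraction[OF assms] by blast
  let ?P = "PiM {..<n} (\<lambda>_. M)"
  have "Measurable.pred ?P (\<lambda>t. \<sigma> (t i) = \<sigma> (t j))" if "i < n" "j < n" for i j
    using r that unfolding baire_retraction_def
    by (intro pred_eq_baire measurable_compose[OF measurable_component_singleton]) auto
  then have "Measurable.pred ?P (\<lambda>t. \<forall>i\<in>{..<n}. \<forall>j\<in>{..<n}. \<sigma> (t i) = \<sigma> (t j) \<longrightarrow> i = j)"
    by (intro pred_intros_finite pred_intros_logic) auto
  then have "{t \<in> space ?P. \<forall>i\<in>{..<n}. \<forall>j\<in>{..<n}. \<sigma> (t i) = \<sigma> (t j) \<longrightarrow> i = j} \<in> sets ?P"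
    by (simp add: pred_def)
  moreover have "\<sigma> (t i) = \<sigma> (t j) \<longleftrightarrow> t i = t j" if "t \<in> space ?P" "i < n" "j < n" for t i j
  proof -
    have "t i \<in> space M" "t j \<in> space M" using that by (auto simp: space_PiM)
    then show ?thesis using r unfolding baire_retraction_def by metis
  qed
  then have "{t \<in> space ?P. \<forall>i\<in>{..<n}. \<forall>j\<in>{..<n}. \<sigma> (t i) = \<sigma> (t j) \<longrightarrow> i = j} =
    {t \<in> space ?P. inj_on t {..<n}}" by (auto simp: inj_on_def)
  ultimately show ?thesis by simp
qed

lemma sets_distinct_tuplesD:
  assumes "standard_borel M" "A \<in> sets (distinct_tuples M n)"
  shows "A \<in> sets (PiM {..<n} (\<lambda>_. M))"
proof -
  obtain A' where A': "A' \<in> sets (PiM {..<n} (\<lambda>_. M))" "A = {x. inj_on x {..<n}} \<inter> A'"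
    using assms(2) unfolding distinct_tuples_def sets_restrict_space by blast
  then have "A = {t \<in> space (PiM {..<n} (\<lambda>_. M)). inj_on t {..<n}} \<inter> A'"
    using sets.sets_into_space[OF A'(1)] by blast
  then show ?thesis using A'(1) sets_inj_tuples[OF assms(1)] by (simp add: sets.Int)
qed

definition instances :: "'a measure \<Rightarrow> nat \<Rightarrow> (nat \<Rightarrow> nat) set \<Rightarrow> (('a \<rightharpoonup> nat) set \<Rightarrow> bool) \<Rightarrow> (nat \<Rightarrow> 'a) set" where
  "instances M n B0 \<Phi> =
     {t \<in> space (PiM {..<n} (\<lambda>_. M)). inj_on t {..<n} \<and> \<Phi> (inst n t ` B0)}"

definition borel_property :: "'a measure \<Rightarrow> nat \<Rightarrow> (('a \<rightharpoonup> nat) set \<Rightarrow> bool) \<Rightarrow> bool" where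
  "borel_property M q \<Phi> \<longleftrightarrow> (\<forall>n B0. B0 \<subseteq> PiE {..<n} (\<lambda>_. {..<q}) \<longrightarrow>
     instances M n B0 \<Phi> \<in> sets (PiM {..<n} (\<lambda>_. M)))"

text \<open>
  Enumerate \<open>B0\<close>. The tuple of the placed members of \<open>B0\<close> depends measurably on \<open>t\<close>, and so does the set
  of these members, by the definition of the Borel structure on finite sets as a quotient.
\<close>

lemma borel_csp_borel_property:
  assumes "standard_borel M" "borel_csp M q \<B>"
  shows "borel_property M q (\<lambda>B. B \<in> \<B>)"
  unfolding borel_property_def
proof (intro allI impI)
  fix n :: nat and B0 :: "(nat \<Rightarrow> nat) set"
  assume B0: "B0 \<subseteq> PiE {..<n} (\<lambda>_. {..<q})"
  let ?DT = "distinct_tuples M n" and ?PF = "partial_function_space M q"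
  have spc: "inj_on t {..<n}" "t ` {..<n} \<subseteq> space M" if "t \<in> space ?DT" for t
    using that by (auto simp: distinct_tuples_def space_restrict_space space_PiM)
  obtain \<C> where \<C>: "\<C> \<in> sets (finite_subsets ?PF)" "\<B> = {B. is_constraint (space M) q B} \<inter> \<C>"
    using assms(2) unfolding borel_csp_def constraint_space_def sets_restrict_space by blast
  have finB0: "finite B0" using B0 by (rule finite_subset) (intro finite_PiE; simp)
  then obtain b where b: "bij_betw b {..<card B0} B0"
    using ex_bij_betw_nat_finite[OF finB0] by (auto simp: atLeast0LessThan)
  let ?k = "card B0"
  have bB0: "b j \<in> B0" if "j < ?k" for j using b that by (auto simp: bij_betw_def)
  have "(\<lambda>t. \<lambda>j\<in>{..<?k}. inst n t (b j)) \<in> measurable ?DT (distinct_tuples ?PF ?k)"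
  proof (rule measurable_distinct_tuples)
    show "(\<lambda>t. inst n t (b j)) \<in> measurable ?DT ?PF" if "j < ?k" for j
      using bB0[OF that] B0 by (intro measurable_inst) blast
    show "inj_on (\<lambda>j. inst n t (b j)) {..<?k}" if "t \<in> space ?DT" for t
    proof (rule inj_onI)
      fix i j assume ij: "i \<in> {..<?k}" "j \<in> {..<?k}" "inst n t (b i) = inst n t (b j)"
      have "b i \<in> extensional {..<n}" "b j \<in> extensional {..<n}"
        using bB0 ij(1,2) B0 by (auto simp: PiE_def)
      then have "b i = b j" using inst_eqD[OF spc(1)[OF that] ij(3)] by blast
      then show "i = j" using b ij(1,2) by (auto simp: bij_betw_def dest: inj_onD)
    qed
  qed
  from measurable_compose[OF this measurable_image_finite_subsets]
  have "(\<lambda>t. (\<lambda>j. inst n t (b j)) ` {..<?k}) \<in> measurable ?DT (finite_subsets ?PF)" by simp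
  moreover have "(\<lambda>j. inst n t (b j)) ` {..<?k} = inst n t ` B0" for t :: "nat \<Rightarrow> 'a"
    using b by (simp add: bij_betw_def image_image[symmetric])
  ultimately have "(\<lambda>t. inst n t ` B0) \<in> measurable ?DT (finite_subsets ?PF)" by (simp only:)
  from measurable_sets[OF this \<C>(1)]
  have "(\<lambda>t. inst n t ` B0) -` \<C> \<inter> space ?DT \<in> sets (PiM {..<n} (\<lambda>_. M))"
    using sets_distinct_tuplesD[OF assms(1)] by blast
  also have "(\<lambda>t. inst n t ` B0) -` \<C> \<inter> space ?DT = instances M n B0 (\<lambda>B. B \<in> \<B>)"
  proof -
    have "inst n t ` B0 \<in> \<B> \<longleftrightarrow> inst n t ` B0 \<in> \<C>" if "t \<in> space ?DT" for t
      using is_constraint_inst[OF spc[OF that] B0] by (simp add: \<C>(2))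
    moreover have "space ?DT = {t \<in> space (PiM {..<n} (\<lambda>_. M)). inj_on t {..<n}}"
      by (auto simp: distinct_tuples_def space_restrict_space)
    ultimately show ?thesis unfolding instances_def by blast
  qed
  finally show "instances M n B0 (\<lambda>B. B \<in> \<B>) \<in> sets (PiM {..<n} (\<lambda>_. M))" .
qed

lemma borel_property_conj:
  assumes "borel_property M q \<Phi>" "borel_property M q \<Psi>"
  shows "borel_property M q (\<lambda>B. \<Phi> B \<and> \<Psi> B)"
proof -
  have "instances M n B0 (\<lambda>B. \<Phi> B \<and> \<Psi> B) = instances M n B0 \<Phi> \<inter> instances M n B0 \<Psi>" for n B0
    by (auto simp: instances_def)
  then show ?thesis using assms by (simp add: borel_property_def sets.Int)
qed

lemma borel_property_meets:
  assumes "standard_borel M" "T \<in> sets M"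
  shows "borel_property M q (\<lambda>B. \<exists>y\<in>constraint_dom B. y \<in> T)"
  unfolding borel_property_def
proof (intro allI impI)
  fix n :: nat and B0 :: "(nat \<Rightarrow> nat) set"
  let ?P = "PiM {..<n} (\<lambda>_. M)"
  have "Measurable.pred ?P (\<lambda>t. t j \<in> T)" if "j < n" for j
    using that assms(2) by (intro measurable_compose[OF measurable_component_singleton]) auto
  then have "Measurable.pred ?P (\<lambda>t. \<exists>j\<in>{..<n}. t j \<in> T)"
    by (intro pred_intros_finite) auto
  then have 1: "{t \<in> space ?P. \<exists>j\<in>{..<n}. t j \<in> T} \<in> sets ?P" by (simp add: pred_def)
  have "instances M n B0 (\<lambda>B. \<exists>y\<in>constraint_dom B. y \<in> T) =
      (if B0 = {} then {} else {t \<in> space ?P. inj_on t {..<n}} \<inter> {t \<in> space ?P. \<exists>j\<in>{..<n}. t j \<in> T})"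
    by (auto simp: instances_def inst_const_dom)
  then show "instances M n B0 (\<lambda>B. \<exists>y\<in>constraint_dom B. y \<in> T) \<in> sets ?P"
    using 1 sets_inj_tuples[OF assms(1)] by (simp add: sets.Int)
qed

lemma cond_prob_inst:
  assumes "inj_on t {..<n}" "B0 \<subseteq> extensional {..<n}"
  shows "cond_prob q V f (inst n t ` B0) =
    (\<Sum>g\<in>B0. \<Prod>j<n. reveal_weight q V f (t j) (Some (g j)))"
proof (cases "B0 = {}")
  case False
  have "inj_on (inst n t) B0"
    using inst_eqD[OF assms(1)] assms(2) by (intro inj_onI) blast
  then have "cond_prob q V f (inst n t ` B0) =
    (\<Sum>g\<in>B0. \<Prod>x\<in>t ` {..<n}. reveal_weight q V f x (inst n t g x))"
    unfolding cond_prob_def using False by (simp add: sum.reindex inst_const_dom)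
  also have "\<dots> = (\<Sum>g\<in>B0. \<Prod>j<n. reveal_weight q V f (t j) (Some (g j)))"
    using assms(1) by (simp add: prod.reindex inst_apply)
  finally show ?thesis .
qed (simp add: cond_prob_def)

text \<open>
  For a placed constraint the conditional probability is a finite sum of finite products of weights of
  the points of the tuple, hence a measurable function of the tuple.
\<close>

lemma borel_property_overshoots:
  assumes "standard_borel M" "V \<in> sets M" "U \<in> sets M"
    and "f \<in> measurable M (count_space UNIV)" "f' \<in> measurable M (count_space UNIV)"
  shows "borel_property M q (overshoots q \<theta> V U f f')"
  unfolding borel_property_def
proof (intro allI impI)
  fix n :: nat and B0 :: "(nat \<Rightarrow> nat) set"
  assume B0: "B0 \<subseteq> PiE {..<n} (\<lambda>_. {..<q})"
  let ?P = "PiM {..<n} (\<lambda>_. M)"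
  let ?c = "\<lambda>V f t. \<Sum>g\<in>B0. \<Prod>j<n. reveal_weight q V f (t j) (Some (g j))"
  have meas: "(\<lambda>t. ?c V f t) \<in> borel_measurable ?P"
    if [measurable]: "V \<in> sets M" "f \<in> measurable M (count_space UNIV)" for V and f :: "'a \<Rightarrow> nat"
  proof (intro borel_measurable_sum borel_measurable_prod)
    fix g j assume "j \<in> {..<n}"
    then have "(\<lambda>t. t j) \<in> measurable ?P M" by (rule measurable_component_singleton)
    moreover have "(\<lambda>x. reveal_weight q V f x (Some (g j))) \<in> borel_measurable M"
    proof -
      have "(\<lambda>x. reveal_weight q V f x (Some (g j))) =
        (\<lambda>x. if x \<in> V then (if f x = g j then 1 else 0) else 1 / real q)"
        by (auto simp: reveal_weight_def)
      then show ?thesis by (simp only:) measurable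
    qed
    ultimately show "(\<lambda>t. reveal_weight q V f (t j) (Some (g j))) \<in> borel_measurable ?P"
      by (rule measurable_compose)
  qed
  define c c' where "c t = ?c V f t" and "c' t = ?c (V \<union> U) f' t" for t
  have c: "c \<in> borel_measurable ?P" "c' \<in> borel_measurable ?P"
    unfolding c_def c'_def using assms by (intro meas; simp)+
  have "{t \<in> space ?P. 0 < c t \<and> \<theta> * c t \<le> c' t} \<in> sets ?P"
    by (intro sets.sets_Collect_conj borel_measurable_less borel_measurable_le borel_measurable_times
        borel_measurable_const c)
  moreover have "instances M n B0 (overshoots q \<theta> V U f f') =
    {t \<in> space ?P. inj_on t {..<n}} \<inter> {t \<in> space ?P. 0 < c t \<and> \<theta> * c t \<le> c' t}"
  proof -
    have "B0 \<subseteq> extensional {..<n}" using B0 by (auto simp: PiE_def)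
    then show ?thesis by (auto simp: instances_def overshoots_def cond_prob_inst c_def c'_def)
  qed
  ultimately show "instances M n B0 (overshoots q \<theta> V U f f') \<in> sets ?P"
    using sets_inj_tuples[OF assms(1)] by (simp add: sets.Int)
qed

text \<open>
  The set is a countable union of projections of Borel sets of tuples to one coordinate. A projection
  is bounded-to-one: if \<open>x\<close> is an entry of a tuple that places an \<open>n\<close>-point constraint of \<open>\<B>\<close>, then the tuple
  is one of the \<open>n\<^sup>n\<close> tuples in the domain of one of the at most \<open>d + 1\<close> constraints at \<open>x\<close>.
\<close>

lemma sets_points_of_constraints:
  assumes "standard_borel M" "borel_csp M q \<B>" "borel_property M q \<Phi>"
    and d: "\<And>B. B \<in> \<B> \<Longrightarrow> finite (csp_neighbours \<B> B) \<and> card (csp_neighbours \<B> B) \<le> d"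
  shows "{x. \<exists>B\<in>\<B>. x \<in> constraint_dom B \<and> \<Phi> B} \<in> sets M"
proof -
  let ?\<Psi> = "\<lambda>B. B \<in> \<B> \<and> \<Phi> B"
  have csp: "is_constraint (space M) q B" if "B \<in> \<B>" for B
    using assms(2) that by (simp add: borel_csp_def is_csp_def)
  have \<Psi>: "borel_property M q ?\<Psi>"
    by (intro borel_property_conj borel_csp_borel_property assms)
  have proj: "(\<lambda>t. t i) ` instances M n B0 ?\<Psi> \<in> sets M"
    if B0: "B0 \<subseteq> PiE {..<n} (\<lambda>_. {..<q})" "B0 \<noteq> {}" and "i < n" for n B0 i
  proof (rule standard_borel_projection_bounded_to_one[OF assms(1) _ \<open>i < n\<close>])
    show "instances M n B0 ?\<Psi> \<in> sets (PiM {..<n} (\<lambda>_. M))"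
      using \<Psi> B0(1) by (simp add: borel_property_def)
    fix x
    let ?Bs = "{B \<in> \<B>. x \<in> constraint_dom B}"
    let ?T = "\<Union>B\<in>{B \<in> ?Bs. card (constraint_dom B) = n}. PiE {..<n} (\<lambda>_. constraint_dom B)"
    have Bs: "finite ?Bs" "card ?Bs \<le> d + 1" using finite_constraints_at[OF d] by blast+
    have sub: "{t \<in> instances M n B0 ?\<Psi>. t i = x} \<subseteq> ?T"
    proof
      fix t assume t: "t \<in> {t \<in> instances M n B0 ?\<Psi>. t i = x}"
      then have *: "inj_on t {..<n}" "inst n t ` B0 \<in> \<B>" "t i = x" "t \<in> extensional {..<n}"
        by (auto simp: instances_def space_PiM PiE_def)
      have dom: "constraint_dom (inst n t ` B0) = t ` {..<n}" using B0(2) by (simp add: inst_const_dom)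
      then have "inst n t ` B0 \<in> {B \<in> ?Bs. card (constraint_dom B) = n}"
        using * \<open>i < n\<close> by (auto simp: card_image)
      moreover have "t \<in> PiE {..<n} (\<lambda>_. constraint_dom (inst n t ` B0))"
        using dom * by (auto simp: PiE_def)
      ultimately show "t \<in> ?T" by blast
    qed
    have finB: "finite {B \<in> ?Bs. card (constraint_dom B) = n}"
      using Bs(1) by (rule finite_subset[rotated]) blast
    have "finite ?T"
    proof (intro finite_UN_I finite_PiE finB)
    qed (use csp is_constraintD(1) in auto)
    moreover have "card ?T \<le> (d + 1) * n ^ n"
    proof -
      have "card ?T \<le> (\<Sum>B\<in>{B \<in> ?Bs. card (constraint_dom B) = n}. card (PiE {..<n} (\<lambda>_. constraint_dom B)))"
        using finB by (rule card_UN_le)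
      also have "\<dots> = (\<Sum>B\<in>{B \<in> ?Bs. card (constraint_dom B) = n}. n ^ n)"
        by (intro sum.cong refl) (simp add: card_PiE)
      also have "\<dots> = card {B \<in> ?Bs. card (constraint_dom B) = n} * n ^ n" by simp
      also have "\<dots> \<le> card ?Bs * n ^ n" using Bs(1) by (intro mult_right_mono card_mono) auto
      also have "\<dots> \<le> (d + 1) * n ^ n" using Bs(2) by (intro mult_right_mono) auto
      finally show ?thesis .
    qed
    ultimately show "finite {t \<in> instances M n B0 ?\<Psi>. t i = x} \<and>
        card {t \<in> instances M n B0 ?\<Psi>. t i = x} \<le> (d + 1) * n ^ n"
      using finite_subset[OF sub] card_mono[OF _ sub] by linarith
  qed
  have "(\<Union>n. \<Union>B0\<in>Pow (PiE {..<n} (\<lambda>_. {..<q})) - {{}}. \<Union>i\<in>{..<n}.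
      (\<lambda>t. t i) ` instances M n B0 ?\<Psi>) \<in> sets M"
  proof (intro sets.countable_UN image_subsetI sets.finite_UN)
    fix n :: nat show "finite (Pow (PiE {..<n} (\<lambda>_. {..<q})) - {{}})" by (simp add: finite_PiE)
  next
    fix n :: nat and B0 i assume "B0 \<in> Pow (PiE {..<n} (\<lambda>_. {..<q})) - {{}}" "i \<in> {..<n}"
    then show "(\<lambda>t. t i) ` instances M n B0 ?\<Psi> \<in> sets M" by (intro proj) auto
  qed
  also have "(\<Union>n. \<Union>B0\<in>Pow (PiE {..<n} (\<lambda>_. {..<q})) - {{}}. \<Union>i\<in>{..<n}.
      (\<lambda>t. t i) ` instances M n B0 ?\<Psi>) = {x. \<exists>B\<in>\<B>. x \<in> constraint_dom B \<and> \<Phi> B}"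
    (is "?L = ?R")
  proof (intro equalityI subsetI)
    fix x assume "x \<in> ?L"
    then obtain n B0 i t where *: "B0 \<noteq> {}" "i \<in> {..<n}" "t \<in> instances M n B0 ?\<Psi>" "x = t i"
      by (elim UN_E imageE DiffE) blast
    then have "x \<in> constraint_dom (inst n t ` B0)" by (simp add: inst_const_dom)
    then show "x \<in> ?R" using *(3) by (auto simp: instances_def)
  next
    fix x assume "x \<in> ?R"
    then obtain B where B: "B \<in> \<B>" "x \<in> constraint_dom B" "\<Phi> B" by blast
    obtain n t B0 where t: "t \<in> PiE {..<n} (\<lambda>_. space M)" "inj_on t {..<n}"
      "t ` {..<n} = constraint_dom B" "B0 \<subseteq> PiE {..<n} (\<lambda>_. {..<q})" "B = inst n t ` B0"
      using constraint_is_inst[OF csp[OF B(1)]] .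
    have "t \<in> instances M n B0 ?\<Psi>" using t(1,2) B unfolding t(5) instances_def by (simp add: space_PiM)
    moreover obtain i where "i < n" "x = t i" using B(2) t(3) by auto
    moreover have "B0 \<noteq> {}" using B(2) t(5) by (auto simp: constraint_dom_def)
    ultimately have i: "i \<in> {..<n}" "x \<in> (\<lambda>t. t i) ` instances M n B0 ?\<Psi>"
      and B0: "B0 \<in> Pow (PiE {..<n} (\<lambda>_. {..<q})) - {{}}"
      using t(4) by auto
    have "x \<in> (\<Union>i\<in>{..<n}. (\<lambda>t. t i) ` instances M n B0 ?\<Psi>)" using i by (rule UN_I)
    from UN_I[of B0 _ _ "\<lambda>B0. \<Union>i\<in>{..<n}. (\<lambda>t. t i) ` instances M n B0 ?\<Psi>", OF B0 this] show "x \<in> ?L" by (rule UN_I[OF UNIV_I])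
  qed
  finally show ?thesis .
qed


section \<open>Colouring the parts of the partition\<close>

text \<open>
  A finite set of points is separated by sufficiently long prefixes of their codes. The members of the
  family are the finite tables that assign colours to prefixes of a fixed length.
\<close>

lemma borel_extension_family:
  assumes "standard_borel M" "q > 0"
  shows "\<exists>\<phi> :: nat \<Rightarrow> 'a \<Rightarrow> nat. (\<forall>k. \<phi> k \<in> measurable M (count_space {..<q})) \<and>
    (\<forall>C h. finite C \<and> C \<subseteq> space M \<and> h \<in> C \<rightarrow> {..<q} \<longrightarrow> (\<exists>k. \<forall>x\<in>C. \<phi> k x = h x))"
proof (cases "space M = {}")
  case True
  then show ?thesis using assms(2) by (intro exI[of _ "\<lambda>_ _. 0"]) auto
next
  case False
  then obtain \<sigma> r where r: "baire_retraction M \<sigma> r"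
    using standard_borel_baire_retraction[OF assms(1)] by blast
  define prefix where "prefix m x = map (\<sigma> x) [0..<m]" for m x
  define \<phi> :: "nat \<Rightarrow> 'a \<Rightarrow> nat" where
    "\<phi> k x = (case from_nat k :: nat \<times> (nat list \<times> nat) list of (m, ps) \<Rightarrow>
       case map_of ps (prefix m x) of None \<Rightarrow> 0 | Some c \<Rightarrow> if c < q then c else 0)" for k x
  have prefix_meas: "prefix m \<in> measurable M (count_space UNIV)" for m
    unfolding measurable_count_space_eq2_countable
  proof (intro conjI ballI)
    fix l :: "nat list"
    have [measurable]: "(\<lambda>x. \<sigma> x i) \<in> measurable M (count_space UNIV)" for i
      using r by (intro measurable_compose[OF _ measurable_coordinate]) (simp add: baire_retraction_def)
    have "prefix m x = l \<longleftrightarrow> length l = m \<and> (\<forall>i\<in>{..<m}. \<sigma> x i = l ! i)" for x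
      unfolding prefix_def list_eq_iff_nth_eq by auto
    then have "prefix m -` {l} \<inter> space M = {x \<in> space M. length l = m \<and> (\<forall>i\<in>{..<m}. \<sigma> x i = l ! i)}"
      by blast
    also have "\<dots> \<in> sets M" by measurable
    finally show "prefix m -` {l} \<inter> space M \<in> sets M" .
  qed auto
  show ?thesis
  proof (intro exI[of _ \<phi>] conjI allI impI, goal_cases)
    case (1 k)
    obtain m ps where k: "from_nat k = (m :: nat, ps :: (nat list \<times> nat) list)" by fastforce
    have "(\<lambda>l. case map_of ps l of None \<Rightarrow> 0 | Some c \<Rightarrow> if c < q then c else 0)
      \<in> measurable (count_space UNIV) (count_space {..<q})"
      using assms(2) by (auto split: option.split)
    from measurable_compose[OF prefix_meas this]
    show "\<phi> k \<in> measurable M (count_space {..<q})" unfolding \<phi>_def k by simp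
  next
    case (2 C h)
    then have C: "finite C" "C \<subseteq> space M" and h: "h \<in> C \<rightarrow> {..<q}" by auto
    have "\<exists>i. \<sigma> x i \<noteq> \<sigma> y i" if "x \<in> C" "y \<in> C" "x \<noteq> y" for x y
    proof -
      have "r (\<sigma> x) = x" "r (\<sigma> y) = y" using r C(2) that unfolding baire_retraction_def by blast+
      then have "\<sigma> x \<noteq> \<sigma> y" using that(3) by metis
      then show ?thesis by (auto simp: fun_eq_iff)
    qed
    then obtain e where e: "\<And>x y. x \<in> C \<Longrightarrow> y \<in> C \<Longrightarrow> x \<noteq> y \<Longrightarrow> \<sigma> x (e x y) \<noteq> \<sigma> y (e x y)"
      by metis
    have "finite ((\<lambda>(x, y). e x y) ` (C \<times> C))" using C(1) by simp
    then obtain m where m: "(\<lambda>(x, y). e x y) ` (C \<times> C) \<subseteq> {..<m}" using finite_nat_bounded by blast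
    have inj: "inj_on (prefix m) C"
    proof (rule inj_onI, rule ccontr)
      fix x y assume xy: "x \<in> C" "y \<in> C" "prefix m x = prefix m y" "x \<noteq> y"
      then have "e x y < m" using m by auto
      then have "\<sigma> x (e x y) = \<sigma> y (e x y)"
        using arg_cong[OF xy(3), of "\<lambda>l. l ! e x y"] by (simp add: prefix_def)
      then show False using e xy by blast
    qed
    obtain xs where xs: "set xs = C" "distinct xs" using finite_distinct_list[OF C(1)] by blast
    define ps where "ps = map (\<lambda>x. (prefix m x, h x)) xs"
    have "distinct (map fst ps)"
      using xs inj by (simp add: ps_def distinct_map o_def)
    then have "map_of ps (prefix m x) = Some (h x)" if "x \<in> C" for x
      using that xs(1) by (intro map_of_is_SomeI) (auto simp: ps_def)
    then have "\<phi> (to_nat (m, ps)) x = h x" if "x \<in> C" for x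
      using that h by (auto simp: \<phi>_def)
    then show "\<exists>k. \<forall>x\<in>C. \<phi> k x = h x" by blast
  qed
qed

text \<open>
  One stage. The colouring \<open>ext k\<close> uses \<open>\<phi> k\<close> on \<open>U\<close>, and \<open>T k\<close> is the set of points of \<open>U\<close> whose component
  meets a constraint with a bad event under \<open>ext k\<close>. It is Borel, being generated from the points of
  these constraints by repeatedly adding adjacent points. By \<open>component_colouring\<close> every point is
  outside \<open>T k\<close> for some \<open>k\<close>, and the least such \<open>k\<close> is the same at all points of a component, because
  \<open>T k\<close> is a union of components.
\<close>

lemma borel_stage:
  fixes \<B> :: "('a \<rightharpoonup> nat) set set"
  assumes M: "standard_borel M" and csp: "borel_csp M q \<B>" and "q > 0"
    and d: "\<And>B. B \<in> \<B> \<Longrightarrow> finite (csp_neighbours \<B> B) \<and> card (csp_neighbours \<B> B) \<le> d"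
    and U: "U \<in> sets M" and V: "V \<in> sets M" and UV: "U \<inter> V = {}"
    and fin: "component_finite U (csp_graph (space M) \<B> \<inter> U \<times> U)"
    and f: "f \<in> measurable M (count_space {..<q})"
  defines "\<theta> \<equiv> exp 1 * (real d + 1)"
  shows "\<exists>f' \<in> measurable M (count_space {..<q}). (\<forall>x. x \<notin> U \<longrightarrow> f' x = f x) \<and>
    (\<forall>B\<in>\<B>. \<not> overshoots q \<theta> V U f f' B)"
proof -
  have constraint: "is_constraint (space M) q B" if "B \<in> \<B>" for B
    using csp that by (simp add: borel_csp_def is_csp_def)
  have U_sub: "U \<subseteq> space M" using sets.sets_into_space[OF U] .
  obtain \<phi> :: "nat \<Rightarrow> 'a \<Rightarrow> nat" where \<phi>: "\<And>k. \<phi> k \<in> measurable M (count_space {..<q})"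
    "\<And>C h. finite C \<Longrightarrow> C \<subseteq> space M \<Longrightarrow> h \<in> C \<rightarrow> {..<q} \<Longrightarrow> \<exists>k. \<forall>x\<in>C. \<phi> k x = h x"
    using borel_extension_family[OF M \<open>q > 0\<close>] by metis
  define ext where "ext k x = (if x \<in> U then \<phi> k x else f x)" for k x
  have ext_meas: "ext k \<in> measurable M (count_space {..<q})" for k
    unfolding ext_def using U by (intro measurable_If_set f \<phi>(1)) auto
  define bad where "bad k = overshoots q \<theta> V U f (ext k)" for k
  have to_UNIV: "g \<in> measurable M (count_space UNIV)" if "g \<in> measurable M (count_space {..<q})" for g
    using measurable_compose[OF that, of id "count_space UNIV"] by simp
  have bad_borel: "borel_property M q (bad k)" for k
    unfolding bad_def using f ext_meas by (intro borel_property_overshoots M V U to_UNIV)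
  define T0 where "T0 k = U \<inter> {x. \<exists>B\<in>\<B>. x \<in> constraint_dom B \<and> bad k B}" for k
  \<comment> \<open>the points that share a constraint with a point of \<open>S\<close>\<close>
  define spread where "spread S = U \<inter> {x. \<exists>B\<in>\<B>. x \<in> constraint_dom B \<and> (\<exists>y\<in>constraint_dom B. y \<in> S)}" for S
  define T where "T k = (\<Union>m. (spread ^^ m) (T0 k))" for k
  have "(spread ^^ m) (T0 k) \<in> sets M" for m k
  proof (induction m)
    case 0
    show ?case
      unfolding T0_def using U sets_points_of_constraints[OF M csp bad_borel d] by (simp add: sets.Int)
  next
    case (Suc m)
    then show ?case
      using U sets_points_of_constraints[OF M csp borel_property_meets[OF M Suc] d]
      by (simp add: spread_def sets.Int)
  qed
  then have T_meas: "T k \<in> sets M" for k unfolding T_def by blast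
  have T_bad: "x \<in> T k" if "x \<in> U" "B \<in> \<B>" "x \<in> constraint_dom B" "bad k B" for x k B
  proof -
    have "x \<in> (spread ^^ 0) (T0 k)" using that by (auto simp: T0_def)
    then show ?thesis unfolding T_def by blast
  qed
  have T_spread: "x \<in> T k"
    if x: "x \<in> U" "B \<in> \<B>" "x \<in> constraint_dom B" and y: "y \<in> constraint_dom B" "y \<in> T k" for x y k B
  proof -
    obtain m where "y \<in> (spread ^^ m) (T0 k)" using y(2) unfolding T_def by blast
    then have "x \<in> (spread ^^ Suc m) (T0 k)" using x y(1) by (auto simp: spread_def)
    then show ?thesis unfolding T_def by blast
  qed
  have good_ex: "\<exists>k. x \<notin> T k" if x: "x \<in> U" for x
  proof -
    define E where "E = csp_graph (space M) \<B> \<inter> U \<times> U"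
    define C where "C = E\<^sup>* `` {x}"
    have finC: "finite C" using fin x by (simp add: component_finite_def C_def E_def)
    have "is_csp (space M) q \<B>" using csp by (simp add: borel_csp_def)
    then have "C \<subseteq> U \<and> (\<exists>h \<in> PiE C (\<lambda>_. {..<q}). \<forall>B\<in>\<B>. constraint_dom B \<inter> C \<noteq> {} \<longrightarrow>
        \<not> overshoots q \<theta> V U f (override_on f h C) B)"
      using finC unfolding C_def E_def \<theta>_def
      by (intro component_colouring[OF _ \<open>q > 0\<close> d UV U_sub x])
    then obtain h where C: "C \<subseteq> U" and h: "h \<in> PiE C (\<lambda>_. {..<q})"
      "\<And>B. B \<in> \<B> \<Longrightarrow> constraint_dom B \<inter> C \<noteq> {} \<Longrightarrow> \<not> overshoots q \<theta> V U f (override_on f h C) B"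
      by blast
    have "C \<subseteq> space M" "h \<in> C \<rightarrow> {..<q}" using C U_sub h(1) by (auto simp: PiE_def)
    then obtain k where k: "\<forall>y\<in>C. \<phi> k y = h y" using \<phi>(2)[OF finC] by blast
    have dom_C: "z \<in> C" if "B \<in> \<B>" "y \<in> constraint_dom B" "y \<in> C" "z \<in> constraint_dom B" "z \<in> U" for B y z
    proof -
      have "(y, z) \<in> E\<^sup>*" unfolding E_def
        using that C is_constraintD(2)[OF constraint[OF that(1)]]
        by (intro constraint_dom_in_component[OF that(1)]) auto
      then show ?thesis using that(3) unfolding C_def by (auto intro: rtrancl_trans)
    qed
    have "y \<notin> (spread ^^ m) (T0 k)" if "y \<in> C" for m y
      using that
    proof (induction m arbitrary: y)
      case 0
      show ?case
      proof
        assume "y \<in> (spread ^^ 0) (T0 k)"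
        then obtain B where B: "B \<in> \<B>" "y \<in> constraint_dom B" "bad k B" by (auto simp: T0_def)
        have "cond_prob q (V \<union> U) (ext k) B = cond_prob q (V \<union> U) (override_on f h C) B"
        proof (rule cond_prob_cong)
          fix z assume z: "z \<in> constraint_dom B" "z \<in> V \<union> U"
          show "ext k z = override_on f h C z"
          proof (cases "z \<in> U")
            case True
            then show ?thesis using dom_C[OF B(1,2) 0 z(1)] k by (simp add: ext_def)
          next
            case False
            then show ?thesis using C by (auto simp: ext_def override_on_def)
          qed
        qed simp
        then have "overshoots q \<theta> V U f (override_on f h C) B"
          using B(3) by (simp add: bad_def overshoots_def)
        then show False using h(2)[OF B(1)] B(2) 0 by blast
      qed
    next
      case (Suc m)
      show ?case
      proof
        assume "y \<in> (spread ^^ Suc m) (T0 k)"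
        then obtain B z where B: "B \<in> \<B>" "y \<in> constraint_dom B" "z \<in> constraint_dom B"
          "z \<in> (spread ^^ m) (T0 k)" by (auto simp: spread_def)
        moreover have "(spread ^^ m) (T0 k) \<subseteq> U" by (cases m) (auto simp: T0_def spread_def)
        ultimately have "z \<in> C" using dom_C[OF B(1,2) Suc.prems B(3)] by blast
        then show False using Suc.IH B(4) by blast
      qed
    qed
    moreover have "x \<in> C" by (simp add: C_def)
    ultimately show ?thesis unfolding T_def by blast
  qed
  define \<kappa> where "\<kappa> x = (LEAST k. x \<notin> T k)" for x
  have [measurable]: "T k \<in> sets M" for k by (rule T_meas)
  have \<kappa>_meas: "\<kappa> \<in> measurable M (count_space UNIV)" unfolding \<kappa>_def by measurable
  have \<kappa>_good: "x \<notin> T (\<kappa> x)" if "x \<in> U" for x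
    unfolding \<kappa>_def using good_ex[OF that] by (rule LeastI_ex)
  define f' where "f' x = ext (\<kappa> x) x" for x
  have "f' \<in> measurable M (count_space {..<q})"
    unfolding f'_def by (rule measurable_compose_countable[OF ext_meas \<kappa>_meas])
  moreover have f'_out: "f' x = f x" if "x \<notin> U" for x using that by (simp add: f'_def ext_def)
  moreover have "\<not> overshoots q \<theta> V U f f' B" if B: "B \<in> \<B>" for B
  proof (cases "constraint_dom B \<inter> U = {}")
    case True
    have "cond_prob q (V \<union> U) f' B = cond_prob q V f B"
    proof (rule cond_prob_cong)
      fix x assume x: "x \<in> constraint_dom B"
      show "x \<in> V \<union> U \<longleftrightarrow> x \<in> V" using x True by blast
      show "f' x = f x" using x True f'_out by blast
    qed
    moreover have "\<theta> > 1"
    proof -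
      have "1 < exp (1 :: real)" by simp
      also have "\<dots> \<le> \<theta>" by (simp add: \<theta>_def)
      finally show ?thesis .
    qed
    ultimately show ?thesis by (auto simp: overshoots_def not_le)
  next
    case False
    then obtain y where y: "y \<in> constraint_dom B" "y \<in> U" by blast
    have "\<kappa> x = \<kappa> y" if "x \<in> constraint_dom B" "x \<in> U" for x
    proof -
      have "x \<in> T k \<longleftrightarrow> y \<in> T k" for k using T_spread B that y by blast
      then show ?thesis by (simp add: \<kappa>_def)
    qed
    then have "cond_prob q (V \<union> U) f' B = cond_prob q (V \<union> U) (ext (\<kappa> y)) B"
      by (intro cond_prob_cong) (auto simp: f'_def ext_def)
    then have "overshoots q \<theta> V U f f' B \<longleftrightarrow> bad (\<kappa> y) B" by (simp add: bad_def overshoots_def)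
    then show ?thesis using T_bad[OF y(2) B y(1)] \<kappa>_good[OF y(2)] by blast
  qed
  ultimately show ?thesis by blast
qed

text \<open>
  A product of weights is \<open>0\<close> only if \<open>g\<close> disagrees with a colour that has been revealed, and this remains
  so.
\<close>

lemma cond_prob_zero_stays:
  assumes "is_constraint X q B" "q > 0" "cond_prob q V f B = 0"
    and "\<And>x. x \<in> V \<Longrightarrow> f' x = f x"
  shows "cond_prob q (V \<union> U) f' B = 0"
proof -
  note fin = is_constraintD(1,3)[OF assms(1)]
  have "\<forall>g\<in>B. (\<Prod>x\<in>constraint_dom B. reveal_weight q V f x (g x)) = 0"
    using assms(3) fin(2) unfolding cond_prob_def
    by (subst (asm) sum_nonneg_eq_0_iff) (auto intro!: prod_nonneg simp: reveal_weight_def)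
  then have "(\<Prod>x\<in>constraint_dom B. reveal_weight q (V \<union> U) f' x (g x)) = 0" if "g \<in> B" for g
  proof -
    from \<open>\<forall>g\<in>B. _ g = 0\<close> that
    obtain x where "x \<in> constraint_dom B" "reveal_weight q V f x (g x) = 0"
      using fin(1) by (auto simp: prod_zero_iff)
    then have "x \<in> constraint_dom B" "reveal_weight q (V \<union> U) f' x (g x) = 0"
      using assms(2,4) by (auto simp: reveal_weight_def split: if_splits)
    then show ?thesis using fin(1) by (auto simp: prod_zero_iff)
  qed
  then show ?thesis by (simp add: cond_prob_def)
qed

text \<open>
  For \<open>n > 0\<close> the bound is strict because avoiding the bad event means growing by a factor less than \<open>\<theta>\<close>.
  The strictness is what excludes the value \<open>1\<close> in the end; the last disjunct serves the start of the
  induction, where nothing has been revealed.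
\<close>

lemma borel_stages:
  fixes \<B> :: "('a \<rightharpoonup> nat) set set"
  assumes M: "standard_borel M" and csp: "borel_csp M q \<B>" and "q > 0"
    and d: "\<And>B. B \<in> \<B> \<Longrightarrow> finite (csp_neighbours \<B> B) \<and> card (csp_neighbours \<B> B) \<le> d"
    and U: "\<And>i. i < n \<Longrightarrow> U i \<in> sets M" and disj: "disjoint_family_on U {..<n}"
    and fin: "\<And>i. i < n \<Longrightarrow> component_finite (U i) (csp_graph (space M) \<B> \<inter> U i \<times> U i)"
  defines "\<theta> \<equiv> exp 1 * (real d + 1)"
  shows "\<exists>f \<in> measurable M (count_space {..<q}). \<forall>B\<in>\<B>.
    cond_prob q (\<Union>i<n. U i) f B = 0 \<or> cond_prob q (\<Union>i<n. U i) f B < \<theta> ^ n * constraint_prob q B \<or>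
    (n = 0 \<and> cond_prob q (\<Union>i<n. U i) f B = constraint_prob q B)"
  using U disj fin
proof (induction n)
  case 0
  have "(\<lambda>_. 0) \<in> measurable M (count_space {..<q})" using \<open>q > 0\<close> by simp
  then show ?case by (intro bexI[of _ "\<lambda>_. 0"]) (auto simp: cond_prob_empty)
next
  case (Suc n)
  let ?V = "\<Union>i<n. U i"
  have constraint: "is_constraint (space M) q B" if "B \<in> \<B>" for B
    using csp that by (simp add: borel_csp_def is_csp_def)
  have \<theta>: "\<theta> > 0" by (simp add: \<theta>_def)
  have "disjoint_family_on U {..<n}" using Suc.prems(2) by (auto simp: disjoint_family_on_def)
  then have "\<exists>f \<in> measurable M (count_space {..<q}). \<forall>B\<in>\<B>.
    cond_prob q ?V f B = 0 \<or> cond_prob q ?V f B < \<theta> ^ n * constraint_prob q B \<or>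
    (n = 0 \<and> cond_prob q ?V f B = constraint_prob q B)"
    by (intro Suc.IH Suc.prems(1,3)) auto
  then obtain f where f: "f \<in> measurable M (count_space {..<q})"
    and c: "\<And>B. B \<in> \<B> \<Longrightarrow> cond_prob q ?V f B = 0 \<or> cond_prob q ?V f B < \<theta> ^ n * constraint_prob q B \<or>
    (n = 0 \<and> cond_prob q ?V f B = constraint_prob q B)"
    by blast
  have "U n \<inter> U i = {}" if "i < n" for i
    using disjoint_family_onD[OF Suc.prems(2), of n i] that by simp
  then have UV: "U n \<inter> ?V = {}" by blast
  have V: "?V \<in> sets M" using Suc.prems(1) by (intro sets.finite_UN) auto
  have "\<exists>f' \<in> measurable M (count_space {..<q}). (\<forall>x. x \<notin> U n \<longrightarrow> f' x = f x) \<and>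
      (\<forall>B\<in>\<B>. \<not> overshoots q \<theta> ?V (U n) f f' B)"
    unfolding \<theta>_def
    by (rule borel_stage[OF M csp \<open>q > 0\<close> d Suc.prems(1)[OF lessI] V UV Suc.prems(3)[OF lessI] f])
  then obtain f' where f': "f' \<in> measurable M (count_space {..<q})" "\<And>x. x \<notin> U n \<Longrightarrow> f' x = f x"
    "\<And>B. B \<in> \<B> \<Longrightarrow> \<not> overshoots q \<theta> ?V (U n) f f' B"
    by blast
  have V_Suc: "(\<Union>i<Suc n. U i) = ?V \<union> U n" by (auto simp: less_Suc_eq)
  have "cond_prob q (?V \<union> U n) f' B = 0 \<or> cond_prob q (?V \<union> U n) f' B < \<theta> ^ Suc n * constraint_prob q B"
    if B: "B \<in> \<B>" for B
  proof (cases "cond_prob q ?V f B = 0")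
    case True
    then have "cond_prob q (?V \<union> U n) f' B = 0"
      using UV f'(2) by (intro cond_prob_zero_stays[OF constraint[OF B] \<open>q > 0\<close> True]) blast
    then show ?thesis ..
  next
    case False
    then have "cond_prob q ?V f B > 0" using cond_prob_nonneg[of q ?V f B] by simp
    then have "cond_prob q (?V \<union> U n) f' B < \<theta> * cond_prob q ?V f B"
      using f'(3)[OF B] by (simp add: overshoots_def)
    also have "\<dots> \<le> \<theta> * (\<theta> ^ n * constraint_prob q B)"
      using c[OF B] False \<theta> by (intro mult_left_mono) auto
    finally show ?thesis by (simp add: mult.assoc)
  qed
  then show ?case unfolding V_Suc using f'(1) by blast
qed

section \<open>Borel solutions\<close>

theorem theorem1p29:
  fixes M :: "'a measure" and q s :: nat and \<B> :: "('a \<rightharpoonup> nat) set set"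
  assumes "standard_borel M"
    and "q > 0"
    and "borel_csp M q \<B>"
    and "separation_index M (csp_graph (space M) \<B>) \<le> enat s"
    and "csp_d \<B> < \<infinity>"
    and "csp_p q \<B> * (ennreal_of_enat (csp_d \<B>) + 1) ^ (s + 1) \<le> ennreal (exp (- real s - 1))"
  shows "\<exists>f. f \<in> measurable M (count_space {..<q}) \<and> is_solution (space M) q \<B> f"
proof -
  let ?E = "csp_graph (space M) \<B>"
  define S where "S = {s :: nat. \<exists>U. (\<forall>i\<le>s. U i \<in> sets M) \<and> disjoint_family_on U {..s} \<and>
    (\<Union>i\<le>s. U i) = space M \<and> (\<forall>i\<le>s. component_finite (U i) (?E \<inter> U i \<times> U i))}"
  have si: "Inf (enat ` S) \<le> enat s" using assms(4) unfolding separation_index_def S_def .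
  then have ne: "enat ` S \<noteq> {}" by (auto simp: Inf_enat_def)
  then have "Inf (enat ` S) \<in> enat ` S" unfolding Inf_enat_def by (auto intro: LeastI)
  then obtain s0 where "s0 \<in> S" "s0 \<le> s" using si by auto
  then obtain U where U: "\<And>i. i \<le> s0 \<Longrightarrow> U i \<in> sets M" "disjoint_family_on U {..s0}"
    "(\<Union>i\<le>s0. U i) = space M" "\<And>i. i \<le> s0 \<Longrightarrow> component_finite (U i) (?E \<inter> U i \<times> U i)"
    unfolding S_def by blast
  obtain d where d: "csp_d \<B> = enat d" using assms(5) by (cases "csp_d \<B>") auto
  have deg: "finite (csp_neighbours \<B> B) \<and> card (csp_neighbours \<B> B) \<le> d" if "B \<in> \<B>" for B
  proof -
    have "(if finite (csp_neighbours \<B> B) then enat (card (csp_neighbours \<B> B)) else \<infinity>) \<le> enat d"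
      unfolding d[symmetric] csp_d_def using that by (rule SUP_upper)
    then show ?thesis by (auto split: if_splits)
  qed
  define \<theta> where "\<theta> = exp 1 * (real d + 1)"
  have constraint: "is_constraint (space M) q B" if "B \<in> \<B>" for B
    using assms(3) that by (simp add: borel_csp_def is_csp_def)
  have P: "\<theta> ^ Suc s0 * constraint_prob q B \<le> 1" if B: "B \<in> \<B>" for B
  proof -
    have P0: "constraint_prob q B \<ge> 0" by (simp add: constraint_prob_def)
    have "ennreal (constraint_prob q B * (real d + 1) ^ (s + 1)) =
        ennreal (constraint_prob q B) * (ennreal_of_enat (csp_d \<B>) + 1) ^ (s + 1)"
    proof -
      have "ennreal_of_enat (csp_d \<B>) + 1 = ennreal (real d) + ennreal 1"
        by (simp add: d ennreal_of_nat_eq_real_of_nat)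
      also have "\<dots> = ennreal (real d + 1)" by (rule ennreal_plus[symmetric]) simp_all
      finally have eq: "ennreal_of_enat (csp_d \<B>) + 1 = ennreal (real d + 1)" .
      have "ennreal (real d + 1) ^ (s + 1) = ennreal ((real d + 1) ^ (s + 1))"
        by (rule ennreal_power) simp
      then show ?thesis unfolding eq by (simp only:) (rule ennreal_mult[OF P0], simp)
    qed
    also have "\<dots> \<le> csp_p q \<B> * (ennreal_of_enat (csp_d \<B>) + 1) ^ (s + 1)"
      unfolding csp_p_def using B by (intro mult_right_mono SUP_upper) auto
    also have "\<dots> \<le> ennreal (exp (- real s - 1))" by (rule assms(6))
    finally have "constraint_prob q B * (real d + 1) ^ (s + 1) \<le> exp (- real s - 1)"
      by (simp add: ennreal_le_iff)
    then have "exp (real s + 1) * (constraint_prob q B * (real d + 1) ^ (s + 1)) \<le>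
        exp (real s + 1) * exp (- real s - 1)" by (intro mult_left_mono) auto
    also have "\<dots> = 1" by (simp add: exp_add[symmetric])
    also have "exp (real s + 1) = exp 1 ^ (s + 1)"
      using exp_of_nat_mult[of "s + 1" "1 :: real"]
      by (simp only: of_nat_add of_nat_1 mult_1_right)
    finally have "\<theta> ^ (s + 1) * constraint_prob q B \<le> 1"
      by (simp add: \<theta>_def power_mult_distrib mult_ac)
    moreover have "\<theta> ^ Suc s0 \<le> \<theta> ^ (s + 1)"
    proof (rule power_increasing)
      have "1 \<le> exp (1 :: real)" by simp
      also have "\<dots> \<le> \<theta>" by (simp add: \<theta>_def)
      finally show "1 \<le> \<theta>" .
    qed (use \<open>s0 \<le> s\<close> in simp)
    then have "\<theta> ^ Suc s0 * constraint_prob q B \<le> \<theta> ^ (s + 1) * constraint_prob q B"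
      using P0 by (rule mult_right_mono)
    ultimately show ?thesis by linarith
  qed
  have lessThan: "{..<Suc s0} = {..s0}" by auto
  have "\<exists>f \<in> measurable M (count_space {..<q}). \<forall>B\<in>\<B>.
    cond_prob q (\<Union>i<Suc s0. U i) f B = 0 \<or>
    cond_prob q (\<Union>i<Suc s0. U i) f B < \<theta> ^ Suc s0 * constraint_prob q B \<or>
    (Suc s0 = 0 \<and> cond_prob q (\<Union>i<Suc s0. U i) f B = constraint_prob q B)"
    unfolding \<theta>_def using U by (intro borel_stages[OF assms(1,3,2) deg]) (simp_all add: lessThan)
  then obtain f where f: "f \<in> measurable M (count_space {..<q})"
    "\<And>B. B \<in> \<B> \<Longrightarrow> cond_prob q (space M) f B = 0 \<or>
      cond_prob q (space M) f B < \<theta> ^ Suc s0 * constraint_prob q B"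
    unfolding lessThan U(3) by blast
  have "\<not> violates f B" if B: "B \<in> \<B>" for B
  proof
    assume "violates f B"
    then have "cond_prob q (space M) f B \<ge> 1"
      using is_constraintD(2)[OF constraint[OF B]] by (intro cond_prob_violated[OF constraint[OF B]])
    then show False using f(2)[OF B] P[OF B] by linarith
  qed
  moreover have "f \<in> space M \<rightarrow> {..<q}" using measurable_space[OF f(1)] by auto
  ultimately show ?thesis using f(1) by (auto simp: is_solution_def)
qed

end
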